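(* Let $M^5\subset\mathbb{C}^3$ be a connected real hypersurface belonging to the General Class $\mathsf{IV}_2$, of smoothness $\mathcal{C}^\kappa$ with $\kappa\geqslant 4$, or $\mathcal{C}^\infty$, or $\mathcal{C}^\omega$, with its biholomorphically invariant $(1,0)$ CR bundle $T^{1,0}M\subset\mathbb{C}\otimes_{\mathbb{R}}TM$ and its Levi-kernel bundle $K^{1,0}M\subset T^{1,0}M$. For any choice of local vector fields $\mathcal{K},\mathcal{L}_1$ such that $\mathcal{K}$ generates $K^{1,0}M$ and $\{\mathcal{K},\mathcal{L}_1\}$ is a local frame for $T^{1,0}M$, the associated frame $$\big\{\mathcal{K},\ \mathcal{L}_1,\ \overline{\mathcal{K}},\ \overline{\mathcal{L}}_1,\ \mathcal{T}\big\},\qquad \mathcal{T}:=\sqrt{-1}\,[\mathcal{L}_1,\overline{\mathcal{L}}_1],$$ for the full complexified tangent bundle $\mathbb{C}\otimes_{\mathbb{R}}TM$ performs a reduction of the full $\mathsf{GL}_5(\mathbb{C})$-structure of $\mathbb{C}\otimes_{\mathbb{R}}TM$ to the subgroup of real dimension $10$ $$\mathsf{G}_{\mathsf{IV}_2}^{\mathsf{initial}}:=\left\{\begin{pmatrix}\mathsf{c}&0&0&0&0\\ \mathsf{b}&\mathsf{a}&0&0&0\\0&0&\overline{\mathsf{c}}&0&0\\0&0&\overline{\mathsf{b}}&\overline{\mathsf{a}}&0\\ \mathsf{e}&\mathsf{d}&\overline{\mathsf{e}}&\overline{\mathsf{d}}&\mathsf{a}\overline{\mathsf{a}}\end{pmatrix}:\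 \mathsf{a},\mathsf{c}\in\mathbb{C}\setminus\{0\},\ \mathsf{b},\mathsf{d},\mathsf{e}\in\mathbb{C}\right\}\subset\mathsf{GL}_5(\mathbb{C}).$$
   Context: For a real hypersurface $M^5\subset\mathbb{C}^3$, $T^{1,0}M\subset\mathbb{C}\otimes_{\mathbb{R}}TM$ is the complex rank-$2$ bundle of $(1,0)$ vectors tangent to $M$, and $T^{0,1}M=\overline{T^{1,0}M}$. The Levi form at $q$ sends $(X_q,Y_q)\in T^{1,0}_qM\times T^{1,0}_qM$ to $\sqrt{-1}[X,\overline{Y}]_q$ mod $T^{1,0}_qM\oplus T^{0,1}_qM$, for local sections $X,Y$ of $T^{1,0}M$ extending $X_q,Y_q$. General Class $\mathsf{IV}_2$ is one of the classes of the Merker–Pocchiola–Sabzevari classification of CR manifolds of dimension at most $5$. It consists of the hypersurfaces $M^5\subset\mathbb{C}^3$ such that: (i) the kernel of the Levi form in $T^{1,0}M$ is everywhere of complex rank $1$, and so forms a rank-$1$ complex subbundle $K^{1,0}M\subset T^{1,0}M$; and (ii) the Freeman form is nondegenerate at every point, that is, for any local generator $\mathcal{K}$ of $K^{1,0}M$ and any local section $\mathcal{L}_1$ completing it to a frame of $T^{1,0}M$, the bracket $[\mathcal{K},\overline{\mathcal{L}}_1]$ is at every point nonzero modulo $K^{1,0}M\oplus T^{0,1}M$. Local generators and frames are taken of the natural smoothness of the bundles (such that the brackets used are defined). "Performs a reduction of the full $\mathsf{GL}_5(\mathbb{C})$-structure to a subgroup $\mathsf{G}$" means: $\mathsf{G}$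 is a closed subgroup of $\mathsf{GL}_5(\mathbb{C})$, and for any two such choices of $(\mathcal{K},\mathcal{L}_1)$ defined on a common open subset $V\subset M$, the two associated frames, written as column vectors, are related at each point of $V$ by left multiplication by a matrix belonging to $\mathsf{G}$ (with entries functions on $V$). *)

theory Defs
  imports "HOL-Analysis.Analysis" "HOL-Library.Set_Algebras" "HOL-Algebra.Group"
begin

section \<open>Regularity classes of maps\<close>

datatype regularity = Ck nat | Cinf | Comega

text \<open>The class obtained by losing \<open>j\<close> derivatives.\<close>

fun lower :: "regularity \<Rightarrow> nat \<Rightarrow> regularity" where
  "lower (Ck k) j = Ck (k - j)"
| "lower Cinf j = Cinf"
| "lower Comega j = Comega"

fun Ck_on :: "nat \<Rightarrow> 'a set \<Rightarrow> ('a::euclidean_space \<Rightarrow> 'b::real_normed_vector) \<Rightarrow> bool" where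
  "Ck_on 0 U f \<longleftrightarrow> continuous_on U f"
| "Ck_on (Suc k) U f \<longleftrightarrow>
     (\<forall>x\<in>U. f differentiable (at x)) \<and>
     (\<forall>v. Ck_on k U (\<lambda>x. frechet_derivative f (at x) v))"

definition multi_indices :: "('a::euclidean_space \<Rightarrow> nat) set" where
  "multi_indices = {\<alpha>. \<forall>i. i \<notin> Basis \<longrightarrow> \<alpha> i = 0}"

definition locally_power_series ::
  "'a set \<Rightarrow> ('a::euclidean_space \<Rightarrow> 'b::real_normed_vector) \<Rightarrow> bool" where
  "locally_power_series U f \<longleftrightarrow>
     (\<forall>p\<in>U. \<exists>r>0. \<exists>c. \<forall>x\<in>ball p r.
        ((\<lambda>\<alpha>. (\<Prod>i\<in>Basis. ((x - p) \<bullet> i) ^ \<alpha> i) *\<^sub>R c \<alpha>) has_sum f x) multi_indices)"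

fun of_class ::
  "regularity \<Rightarrow> 'a set \<Rightarrow> ('a::euclidean_space \<Rightarrow> 'b::real_normed_vector) \<Rightarrow> bool" where
  "of_class (Ck k) U f \<longleftrightarrow> Ck_on k U f"
| "of_class Cinf U f \<longleftrightarrow> (\<forall>k. Ck_on k U f)"
| "of_class Comega U f \<longleftrightarrow> (\<forall>k. Ck_on k U f) \<and> locally_power_series U f"

text \<open>\<^const>\<open>of_class\<close> is meant for open sets. On a subset \<open>V\<close> of a submanifold, a map is of
  a given class if it locally extends to a map of that class on an open set of the ambient
  space.\<close>

definition of_class_on_subset ::
  "regularity \<Rightarrow> 'a set \<Rightarrow> ('a::euclidean_space \<Rightarrow> 'b::real_normed_vector) \<Rightarrow> bool" where
  "of_class_on_subset r V f \<longleftrightarrow>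
     (\<forall>p\<in>V. \<exists>U g. open U \<and> p \<in> U \<and> of_class r U g \<and> (\<forall>x\<in>V \<inter> U. f x = g x))"

text \<open>Submanifolds of dimension \<open>n\<close>, by slice charts.\<close>

definition embedded_submanifold :: "regularity \<Rightarrow> nat \<Rightarrow> 'a::euclidean_space set \<Rightarrow> bool" where
  "embedded_submanifold r n S \<longleftrightarrow>
     (\<forall>p\<in>S. \<exists>U W \<psi> \<phi> L.
        open U \<and> p \<in> U \<and> open W \<and> of_class r U \<psi> \<and> of_class r W \<phi> \<and>
        \<psi> ` U = W \<and> (\<forall>x\<in>U. \<phi> (\<psi> x) = x) \<and>
        subspace (L :: 'a set) \<and> dim L = n \<and> \<psi> ` (S \<inter> U) = W \<inter> L)"

section \<open>Complexification of a real vector space\<close>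

text \<open>The pair \<open>(X, Y)\<close> stands for \<open>X + \<i> Y\<close> in \<open>\<complex> \<otimes>\<^sub>\<real> V\<close>.\<close>

definition cscale :: "complex \<Rightarrow> 'a::real_vector \<times> 'a \<Rightarrow> 'a \<times> 'a" where
  "cscale c Z = (Re c *\<^sub>R fst Z - Im c *\<^sub>R snd Z, Re c *\<^sub>R snd Z + Im c *\<^sub>R fst Z)"

definition cconj :: "'a::real_vector \<times> 'a \<Rightarrow> 'a \<times> 'a" where
  "cconj Z = (fst Z, - snd Z)"

interpretation cplx: vector_space "cscale :: complex \<Rightarrow> 'a::real_vector \<times> 'a \<Rightarrow> 'a \<times> 'a"
  by unfold_locales (auto simp: cscale_def algebra_simps)

section \<open>Real hypersurfaces of \<open>\<complex>\<^sup>3\<close>\<close>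

type_synonym C3 = "complex ^ 3"

definition local_defining_function ::
  "regularity \<Rightarrow> C3 set \<Rightarrow> C3 set \<Rightarrow> (C3 \<Rightarrow> real) \<Rightarrow> bool" where
  "local_defining_function \<kappa> M U \<rho> \<longleftrightarrow>
     open U \<and> of_class \<kappa> U \<rho> \<and> (\<forall>x\<in>U. \<exists>v. frechet_derivative \<rho> (at x) v \<noteq> 0) \<and>
     M \<inter> U = {x \<in> U. \<rho> x = 0}"

definition real_hypersurface :: "regularity \<Rightarrow> C3 set \<Rightarrow> bool" where
  "real_hypersurface \<kappa> M \<longleftrightarrow> (\<forall>p\<in>M. \<exists>U \<rho>. p \<in> U \<and> local_defining_function \<kappa> M U \<rho>)"

definition tangent_space :: "C3 set \<Rightarrow> C3 \<Rightarrow> C3 set" where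
  "tangent_space M p =
     {v. \<exists>U \<rho>. p \<in> U \<and> local_defining_function (Ck 1) M U \<rho> \<and> frechet_derivative \<rho> (at p) v = 0}"

definition CTM :: "C3 set \<Rightarrow> C3 \<Rightarrow> (C3 \<times> C3) set" where
  "CTM M p = tangent_space M p \<times> tangent_space M p"

text \<open>The complex structure of \<open>\<complex>\<^sup>3\<close>, extended \<open>\<complex>\<close>-linearly to \<open>\<complex> \<otimes>\<^sub>\<real> \<complex>\<^sup>3\<close>; the \<open>(1,0)\<close> vectors are
  its eigenvectors for the eigenvalue \<open>\<i>\<close>.\<close>

definition JC :: "C3 \<times> C3 \<Rightarrow> C3 \<times> C3" where
  "JC Z = (\<i> *s fst Z, \<i> *s snd Z)"

definition T10 :: "C3 set \<Rightarrow> C3 \<Rightarrow> (C3 \<times> C3) set" where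
  "T10 M p = {Z \<in> CTM M p. JC Z = cscale \<i> Z}"

definition T01 :: "C3 set \<Rightarrow> C3 \<Rightarrow> (C3 \<times> C3) set" where
  "T01 M p = cconj ` T10 M p"

section \<open>Vector fields, brackets and frames\<close>

type_synonym cfield = "C3 \<Rightarrow> C3 \<times> C3"

text \<open>Derivative of the vector field \<open>Y\<close> along the complexified tangent vector \<open>Z\<close> at \<open>p\<close>.
  The derivative within a hypersurface \<open>M\<close> is determined only on \<open>T\<^sub>pM\<close>, which is where it is
  evaluated when \<open>Z \<in> CTM M p\<close>.\<close>

definition deriv_along :: "C3 set \<Rightarrow> C3 \<Rightarrow> C3 \<times> C3 \<Rightarrow> cfield \<Rightarrow> C3 \<times> C3" where
  "deriv_along M p Z Y =
     (let D = frechet_derivative Y (at p within M) in D (fst Z) + cscale \<i> (D (snd Z)))"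

definition bracket :: "C3 set \<Rightarrow> cfield \<Rightarrow> cfield \<Rightarrow> cfield" where
  "bracket M X Y p = deriv_along M p (X p) Y - deriv_along M p (Y p) X"

definition local_section ::
  "regularity \<Rightarrow> C3 set \<Rightarrow> (C3 \<Rightarrow> (C3 \<times> C3) set) \<Rightarrow> cfield \<Rightarrow> bool" where
  "local_section r V B X \<longleftrightarrow> of_class_on_subset r V X \<and> (\<forall>q\<in>V. X q \<in> B q)"

definition local_frame ::
  "regularity \<Rightarrow> C3 set \<Rightarrow> (C3 \<Rightarrow> (C3 \<times> C3) set) \<Rightarrow> cfield list \<Rightarrow> bool" where
  "local_frame r V B Xs \<longleftrightarrow>
     (\<forall>X\<in>set Xs. local_section r V B X) \<and>
     (\<forall>q\<in>V. let vs = map (\<lambda>X. X q) Xs in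
        distinct vs \<and> cplx.independent (set vs) \<and> cplx.span (set vs) = B q)"

section \<open>Levi form and the class \<open>IV\<^sub>2\<close>\<close>

text \<open>The value of the Levi form is an element of the quotient by \<open>T10 M q + T01 M q\<close>, that is, a
  coset. The union over all extensions is a single coset, as the class does not depend on the
  extensions. The zero of the quotient is \<open>T10 M q + T01 M q\<close> itself.\<close>

definition levi_form ::
  "regularity \<Rightarrow> C3 set \<Rightarrow> C3 \<Rightarrow> C3 \<times> C3 \<Rightarrow> C3 \<times> C3 \<Rightarrow> (C3 \<times> C3) set" where
  "levi_form \<kappa> M q u v =
     \<Union> {cscale \<i> (bracket M X (cconj \<circ> Y) q) +o (T10 M q + T01 M q) | X Y V.
          openin (top_of_set M) V \<and> q \<in> V \<and>
          local_section (lower \<kappa> 1) V (T10 M) X \<and> local_section (lower \<kappa> 1) V (T10 M) Y \<and>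
          X q = u \<and> Y q = v}"

definition levi_kernel :: "regularity \<Rightarrow> C3 set \<Rightarrow> C3 \<Rightarrow> (C3 \<times> C3) set" where
  "levi_kernel \<kappa> M q = {u \<in> T10 M q. \<forall>v\<in>T10 M q. levi_form \<kappa> M q u v = T10 M q + T01 M q}"

text \<open>The choices of \<open>(\<K>, \<L>\<^sub>1)\<close> over an open set \<open>V\<close> of \<open>M\<close>. For \<open>M\<close> of class \<open>C\<^sup>\<kappa>\<close> the bundle
  \<open>T\<^sup>1\<^sup>,\<^sup>0M\<close> is of class \<open>C\<^sup>\<kappa>\<^sup>-\<^sup>1\<close> and the Levi kernel of class \<open>C\<^sup>\<kappa>\<^sup>-\<^sup>2\<close>.\<close>

definition adapted_pair :: "regularity \<Rightarrow> C3 set \<Rightarrow> C3 set \<Rightarrow> cfield \<Rightarrow> cfield \<Rightarrow> bool" where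
  "adapted_pair \<kappa> M V K L1 \<longleftrightarrow>
     openin (top_of_set M) V \<and>
     local_frame (lower \<kappa> 2) V (levi_kernel \<kappa> M) [K] \<and>
     local_section (lower \<kappa> 1) V (T10 M) L1 \<and>
     local_frame (lower \<kappa> 2) V (T10 M) [K, L1]"

definition freeman_nondegenerate :: "regularity \<Rightarrow> C3 set \<Rightarrow> bool" where
  "freeman_nondegenerate \<kappa> M \<longleftrightarrow>
     (\<forall>V K L1. adapted_pair \<kappa> M V K L1 \<longrightarrow>
        (\<forall>q\<in>V. bracket M K (cconj \<circ> L1) q \<notin> levi_kernel \<kappa> M q + T01 M q))"

definition class_IV2 :: "regularity \<Rightarrow> C3 set \<Rightarrow> bool" where
  "class_IV2 \<kappa> M \<longleftrightarrow>
     real_hypersurface \<kappa> M \<and> (\<forall>q\<in>M. cplx.dim (levi_kernel \<kappa> M q) = 1) \<and>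
     freeman_nondegenerate \<kappa> M"

definition associated_frame :: "C3 set \<Rightarrow> cfield \<Rightarrow> cfield \<Rightarrow> cfield list" where
  "associated_frame M K L1 =
     [K, L1, cconj \<circ> K, cconj \<circ> L1, \<lambda>q. cscale \<i> (bracket M L1 (cconj \<circ> L1) q)]"

section \<open>Reductions to subgroups of \<open>GL\<^sub>5(\<complex>)\<close>\<close>

definition GL5 :: "(complex ^ 5 ^ 5) monoid" where
  "GL5 = \<lparr>carrier = {A. invertible A}, mult = (**), one = mat 1\<rparr>"

definition frame_column :: "cfield list \<Rightarrow> C3 \<Rightarrow> (C3 \<times> C3) ^ 5" where
  "frame_column Xs q = vector (map (\<lambda>X. X q) Xs)"

definition act :: "complex ^ 5 ^ 5 \<Rightarrow> (C3 \<times> C3) ^ 5 \<Rightarrow> (C3 \<times> C3) ^ 5" where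
  "act A F = (\<chi> i. \<Sum>j\<in>UNIV. cscale (A $ i $ j) (F $ j))"

definition performs_reduction :: "regularity \<Rightarrow> C3 set \<Rightarrow> (complex ^ 5 ^ 5) set \<Rightarrow> bool" where
  "performs_reduction \<kappa> M G \<longleftrightarrow>
     subgroup G GL5 \<and> closedin (top_of_set (carrier GL5)) G \<and>
     (\<forall>V K L1 K' L1'. adapted_pair \<kappa> M V K L1 \<and> adapted_pair \<kappa> M V K' L1' \<longrightarrow>
        (\<exists>A. \<forall>q\<in>V. A q \<in> G \<and>
           frame_column (associated_frame M K' L1') q = act (A q) (frame_column (associated_frame M K L1) q)))"

definition G_IV2_initial :: "(complex ^ 5 ^ 5) set" where
  "G_IV2_initial =
     {vector [vector [c, 0, 0, 0, 0],
              vector [b, a, 0, 0, 0],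
              vector [0, 0, cnj c, 0, 0],
              vector [0, 0, cnj b, cnj a, 0],
              vector [e, d, cnj e, cnj d, a * cnj a]] | a b c d e. a \<noteq> 0 \<and> c \<noteq> 0}"

end

theory Submission
  imports Defs
begin

text \<open>Let \<open>\<rho>\<close> be a local defining function, \<open>\<partial>\<^sup>2\<rho>\<close> its \<open>\<complex>\<close>-bilinearly extended Hessian at \<open>q\<close> and
  \<open>\<theta>(Z) = d\<rho>(J Z)\<close>, whose kernel in \<open>\<complex> \<otimes> T\<^sub>qM\<close> is \<open>T\<^sup>1\<^sup>,\<^sup>0 \<oplus> T\<^sup>0\<^sup>,\<^sup>1\<close>. Differentiating \<open>d\<rho>(Y) = 0\<close> and
  \<open>d\<rho>(J Y) = 0\<close> along \<open>M\<close> gives \<open>\<theta>([X, cconj Y]) = 2\<i> \<partial>\<^sup>2\<rho>(X, cconj Y)\<close> for sections \<open>X\<close>, \<open>Y\<close> of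
  \<open>T\<^sup>1\<^sup>,\<^sup>0M\<close>. So the Levi form is given by a Hermitian form in the values at \<open>q\<close>, even for fields that are
  only differentiable at \<open>q\<close>, as is needed for \<open>\<K>\<close>, which has one derivative less than \<open>\<L>\<^sub>1\<close>. The form vanishes on \<open>\<K>\<close>
  and not on \<open>\<L>\<^sub>1\<close>; hence \<open>\<T>\<close> completes the frame, and if \<open>\<L>\<^sub>1' = b \<K> + a \<L>\<^sub>1\<close> then \<open>\<T>' - |a|\<^sup>2 \<T>\<close> is a real
  vector in the kernel of \<open>\<theta>\<close>, which gives the last row of the matrix.

  Two analytic points need work: derivatives within \<open>M\<close> are determined on tangent vectors because
  these are limits of secants of \<open>M\<close> (intermediate value theorem), and in the class \<open>C\<^sup>\<omega>\<close> the field \<open>\<T>\<close> is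
  analytic because power series can be multiplied and differentiated term by term.\<close>

section \<open>Maps of class \<open>C\<^sup>k\<close>\<close>

lemma frechet_derivative_cong_open:
  assumes "open U" "x \<in> U" "\<And>y. y \<in> U \<Longrightarrow> f y = g y"
  shows "frechet_derivative f (at x) = frechet_derivative g (at x)"
proof -
  have "(f has_derivative D) (at x) \<longleftrightarrow> (g has_derivative D) (at x)" for D
    using assms by (metis has_derivative_transform_within_open)
  then show ?thesis unfolding frechet_derivative_def by simp
qed

lemma Ck_on_cong:
  assumes "open U" "\<And>y. y \<in> U \<Longrightarrow> f y = g y" "Ck_on k U f"
  shows "Ck_on k U g"
  using assms(2,3)
proof (induction k arbitrary: f g)
  case 0
  then show ?case by (metis Ck_on.simps(1) continuous_on_cong)
next
  case (Suc k)
  have "g differentiable (at x)" if "x \<in> U" for x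
    using Suc.prems that assms(1) unfolding differentiable_def
    by (metis Ck_on.simps(2) differentiable_def has_derivative_transform_within_open)
  moreover have "Ck_on k U (\<lambda>x. frechet_derivative g (at x) v)" for v
  proof (rule Suc.IH)
    show "frechet_derivative f (at y) v = frechet_derivative g (at y) v" if "y \<in> U" for y
      using frechet_derivative_cong_open[OF assms(1) that] Suc.prems(1) by metis
    show "Ck_on k U (\<lambda>x. frechet_derivative f (at x) v)" using Suc.prems by simp
  qed
  ultimately show ?case by simp
qed

lemma Ck_on_Suc_imp: "Ck_on (Suc k) U f \<Longrightarrow> Ck_on k U f"
proof (induction k arbitrary: f)
  case 0
  then show ?case
    by (auto intro!: continuous_at_imp_continuous_on differentiable_imp_continuous_within)
qed auto

lemma Ck_on_mono: "Ck_on k U f \<Longrightarrow> j \<le> k \<Longrightarrow> Ck_on j U f"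
  by (induction k) (auto simp del: Ck_on.simps dest: Ck_on_Suc_imp simp: le_Suc_eq)

text \<open>Any explicit family of derivatives may stand in for \<open>frechet_derivative\<close>;
  this lets the closure properties below go by induction on the order, from the sum and product
  rules.\<close>

lemma Ck_on_SucI:
  assumes "open U" "\<And>x. x \<in> U \<Longrightarrow> (f has_derivative D x) (at x)"
    "\<And>v. Ck_on k U (\<lambda>x. D x v)"
  shows "Ck_on (Suc k) U f"
proof -
  have "frechet_derivative f (at x) = D x" if "x \<in> U" for x
    using frechet_derivative_at[OF assms(2)[OF that]] by simp
  then have "Ck_on k U (\<lambda>x. frechet_derivative f (at x) v)" for v
    using Ck_on_cong[OF assms(1) _ assms(3)[of v]] by simp
  then show ?thesis using assms(2) by (auto simp: differentiable_def)
qed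

lemma Ck_on_SucD:
  assumes "Ck_on (Suc k) U f"
  shows "x \<in> U \<Longrightarrow> (f has_derivative frechet_derivative f (at x)) (at x)"
    and "Ck_on k U (\<lambda>x. frechet_derivative f (at x) v)"
  using assms by (auto simp: frechet_derivative_works)

lemma Ck_on_const: "open U \<Longrightarrow> Ck_on k U (\<lambda>x. c)"
proof (induction k arbitrary: c)
  case (Suc k)
  show ?case by (rule Ck_on_SucI[where D="\<lambda>_ _. 0"]) (use Suc in auto)
qed simp

lemma Ck_on_add:
  assumes "open U" "Ck_on k U f" "Ck_on k U g"
  shows "Ck_on k U (\<lambda>x. f x + g x)"
  using assms(2,3)
proof (induction k arbitrary: f g)
  case (Suc k)
  show ?case
    by (rule Ck_on_SucI[OF assms(1) has_derivative_add
          [OF Ck_on_SucD(1)[OF Suc.prems(1)] Ck_on_SucD(1)[OF Suc.prems(2)]]])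
      (auto intro!: Suc.IH Ck_on_SucD(2) Suc.prems)
qed (auto intro: continuous_on_add)

lemma Ck_on_linear:
  assumes "open U" "bounded_linear h" "Ck_on k U f"
  shows "Ck_on k U (\<lambda>x. h (f x))"
  using assms(3)
proof (induction k arbitrary: f)
  case 0
  then show ?case using assms(2) by (auto intro: bounded_linear.continuous_on)
next
  case (Suc k)
  show ?case
    by (rule Ck_on_SucI[OF assms(1) bounded_linear.has_derivative
          [OF assms(2) Ck_on_SucD(1)[OF Suc.prems(1)]]])
      (auto intro!: Suc.IH Ck_on_SucD(2) Suc.prems)
qed

lemma Ck_on_bilinear:
  assumes "open U" "bounded_bilinear B" "Ck_on k U f" "Ck_on k U g"
  shows "Ck_on k U (\<lambda>x. B (f x) (g x))"
  using assms(3,4)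
proof (induction k arbitrary: f g)
  case 0
  then show ?case using assms(2) by (auto intro: bounded_bilinear.continuous_on)
next
  case (Suc k)
  show ?case
    by (rule Ck_on_SucI[OF assms(1) bounded_bilinear.FDERIV
          [OF assms(2) Ck_on_SucD(1)[OF Suc.prems(1)] Ck_on_SucD(1)[OF Suc.prems(2)]]])
      (auto intro!: Ck_on_add[OF assms(1)] Suc.IH Ck_on_SucD(2) Suc.prems Ck_on_Suc_imp[OF Suc.prems(1)]
        Ck_on_Suc_imp[OF Suc.prems(2)] simp del: Ck_on.simps)
qed

lemma Ck_on_ident: "open U \<Longrightarrow> Ck_on k U (\<lambda>x. x)"
proof (cases k)
  case (Suc j)
  then show "open U \<Longrightarrow> ?thesis"
    using Ck_on_SucI[of U "\<lambda>x. x" "\<lambda>_ v. v" j] Ck_on_const by auto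
qed simp

section \<open>Symmetry of second derivatives\<close>

text \<open>The mean value theorem is applied twice: along \<open>a\<close> to the increment in
  direction \<open>b\<close>, then along \<open>b\<close> to the derivative in direction
  \<open>a\<close>. The mixed difference itself is symmetric in \<open>a\<close> and
  \<open>b\<close>.\<close>

lemma Ck2_mixed_difference:
  fixes f :: "'a::euclidean_space \<Rightarrow> real"
  assumes "open U" "Ck_on 2 U f" "0 < h"
    and sub: "\<And>s t. 0 \<le> s \<Longrightarrow> s \<le> h \<Longrightarrow> 0 \<le> t \<Longrightarrow> t \<le> h \<Longrightarrow> x + s *\<^sub>R a + t *\<^sub>R b \<in> U"
  shows "\<exists>s t. 0 \<le> s \<and> s \<le> h \<and> 0 \<le> t \<and> t \<le> h \<and>
    f (x + h *\<^sub>R a + h *\<^sub>R b) - f (x + h *\<^sub>R a) - f (x + h *\<^sub>R b) + f x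
      = h * h * frechet_derivative (\<lambda>y. frechet_derivative f (at y) a) (at (x + s *\<^sub>R a + t *\<^sub>R b)) b"
proof -
  define D where "D y = frechet_derivative f (at y)" for y
  have df: "(f has_derivative D y) (at y)" if "y \<in> U" for y
    using assms(2) that unfolding D_def by (simp add: numeral_2_eq_2 frechet_derivative_works)
  have dD: "((\<lambda>y. D y a) has_derivative frechet_derivative (\<lambda>y. D y a) (at y)) (at y)"
    if "y \<in> U" for y
    using assms(2) that unfolding D_def by (simp add: numeral_2_eq_2 frechet_derivative_works)
  have lin: "linear (D y)" if "y \<in> U" for y
    using df[OF that] has_derivative_linear by blast
  let ?u = "\<lambda>s. f (x + s *\<^sub>R a + h *\<^sub>R b) - f (x + s *\<^sub>R a)"
  have "\<exists>s. 0 < s \<and> s < h \<and> ?u h - ?u 0 = (h - 0) * (D (x + s *\<^sub>R a + h *\<^sub>R b) a - D (x + s *\<^sub>R a) a)"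
  proof (rule MVT2[OF \<open>0 < h\<close>])
    fix s assume s: "0 \<le> s" "s \<le> h"
    have 1: "x + s *\<^sub>R a + h *\<^sub>R b \<in> U" using sub[OF s, of h] assms(3) by simp
    have 2: "x + s *\<^sub>R a \<in> U" using sub[OF s, of 0] assms(3) by simp
    have "((\<lambda>s. f (x + s *\<^sub>R a + h *\<^sub>R b)) has_derivative (\<lambda>t. D (x + s *\<^sub>R a + h *\<^sub>R b) (t *\<^sub>R a))) (at s)"
      by (rule has_derivative_compose[where g=f and f="\<lambda>s. x + s *\<^sub>R a + h *\<^sub>R b", OF _ df[OF 1]]) (auto intro!: derivative_eq_intros)
    moreover have "((\<lambda>s. f (x + s *\<^sub>R a)) has_derivative (\<lambda>t. D (x + s *\<^sub>R a) (t *\<^sub>R a))) (at s)"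
      by (rule has_derivative_compose[where g=f and f="\<lambda>s. x + s *\<^sub>R a", OF _ df[OF 2]]) (auto intro!: derivative_eq_intros)
    ultimately have "(?u has_derivative (\<lambda>t. D (x + s *\<^sub>R a + h *\<^sub>R b) (t *\<^sub>R a) - D (x + s *\<^sub>R a) (t *\<^sub>R a))) (at s)"
      by (rule has_derivative_diff)
    then show "(?u has_real_derivative (D (x + s *\<^sub>R a + h *\<^sub>R b) a - D (x + s *\<^sub>R a) a)) (at s)"
      unfolding has_field_derivative_def
      by (rule has_derivative_eq_rhs)
        (simp add: fun_eq_iff linear_cmul[OF lin[OF 1]] linear_cmul[OF lin[OF 2]] right_diff_distrib mult.commute)
  qed
  then obtain s where s: "0 < s" "s < h"
    "?u h - ?u 0 = h * (D (x + s *\<^sub>R a + h *\<^sub>R b) a - D (x + s *\<^sub>R a) a)" by auto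
  let ?w = "\<lambda>t. D (x + s *\<^sub>R a + t *\<^sub>R b) a"
  have "\<exists>t. 0 < t \<and> t < h \<and> ?w h - ?w 0 = (h - 0) * frechet_derivative (\<lambda>y. D y a) (at (x + s *\<^sub>R a + t *\<^sub>R b)) b"
  proof (rule MVT2[OF \<open>0 < h\<close>])
    fix t assume t: "0 \<le> t" "t \<le> h"
    have 1: "x + s *\<^sub>R a + t *\<^sub>R b \<in> U" using sub[of s t] s t by simp
    have "((\<lambda>t. D (x + s *\<^sub>R a + t *\<^sub>R b) a) has_derivative
      (\<lambda>r. frechet_derivative (\<lambda>y. D y a) (at (x + s *\<^sub>R a + t *\<^sub>R b)) (r *\<^sub>R b))) (at t)"
      by (rule has_derivative_compose[where g="\<lambda>y. D y a" and f="\<lambda>t. x + s *\<^sub>R a + t *\<^sub>R b", OF _ dD[OF 1]]) (auto intro!: derivative_eq_intros)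
    then show "(?w has_real_derivative frechet_derivative (\<lambda>y. D y a) (at (x + s *\<^sub>R a + t *\<^sub>R b)) b) (at t)"
      by (simp add: has_field_derivative_def linear_cmul[OF has_derivative_linear[OF dD[OF 1]]]
          mult_commute_abs)
  qed
  then obtain t where "0 < t" "t < h"
    "?w h - ?w 0 = h * frechet_derivative (\<lambda>y. D y a) (at (x + s *\<^sub>R a + t *\<^sub>R b)) b" by auto
  then show ?thesis using s unfolding D_def
    by (intro exI[of _ s] exI[of _ t]) (auto simp: algebra_simps)
qed

text \<open>Schwarz's theorem. The mixed difference over a small parallelogram does not depend on
  the order of \<open>a\<close> and \<open>b\<close>, so a value of one mixed derivative near
  \<open>x\<close> equals a value of the other near \<open>x\<close>; continuity of both excludes a
  gap at \<open>x\<close>.\<close>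

lemma Ck2_second_derivative_symmetric:
  fixes f :: "'a::euclidean_space \<Rightarrow> real"
  assumes "open U" "Ck_on 2 U f" "x \<in> U"
  shows "frechet_derivative (\<lambda>y. frechet_derivative f (at y) a) (at x) b
       = frechet_derivative (\<lambda>y. frechet_derivative f (at y) b) (at x) a"
proof -
  let ?H = "\<lambda>a b y. frechet_derivative (\<lambda>y. frechet_derivative f (at y) a) (at y) b"
  have cont: "isCont (?H a b) x" for a b
    using assms by (simp add: numeral_2_eq_2 continuous_on_eq_continuous_at)
  show ?thesis
  proof (rule ccontr)
    assume ne: "?H a b x \<noteq> ?H b a x"
    define e where "e = \<bar>?H a b x - ?H b a x\<bar> / 2"
    have e: "e > 0" using ne by (simp add: e_def)
    obtain d1 where d1: "d1 > 0" "\<And>y. dist y x < d1 \<Longrightarrow> dist (?H a b y) (?H a b x) < e"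
      using cont[of a b] e unfolding continuous_at_eps_delta by blast
    obtain d2 where d2: "d2 > 0" "\<And>y. dist y x < d2 \<Longrightarrow> dist (?H b a y) (?H b a x) < e"
      using cont[of b a] e unfolding continuous_at_eps_delta by blast
    obtain d3 where d3: "d3 > 0" "ball x d3 \<subseteq> U" using assms(1,3) open_contains_ball by blast
    define d where "d = min d1 (min d2 d3)"
    have d: "d > 0" using d1 d2 d3 by (simp add: d_def)
    define P where "P = norm a + norm b + 1"
    have pos: "P > 0" by (simp add: P_def add_nonneg_pos)
    \<comment> \<open>\<open>P\<close> exceeds the sum of the norms and is positive even if
      \<open>a\<close> and \<open>b\<close> vanish; with this \<open>h\<close> the parallelogram
      stays within distance \<open>d / 2\<close> of \<open>x\<close>.\<close>
    define h where "h = d / (2 * P)"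
    have h: "h > 0" using d pos by (simp add: h_def)
    have near: "dist (x + s *\<^sub>R a + t *\<^sub>R b) x < d" if "0 \<le> s" "s \<le> h" "0 \<le> t" "t \<le> h"  for s t
    proof -
      have "norm (s *\<^sub>R a + t *\<^sub>R b) \<le> s * norm a + t * norm b"
        using norm_triangle_ineq[of "s *\<^sub>R a" "t *\<^sub>R b"] that by simp
      also have "\<dots> \<le> h * norm a + h * norm b" using that by (intro add_mono mult_right_mono) auto
      also have "\<dots> < h * P" using h by (simp add: P_def algebra_simps)
      also have "\<dots> = d / 2" using pos by (simp add: h_def)
      also have "\<dots> < d" using d by simp
      finally show ?thesis by (simp add: dist_norm algebra_simps)
    qed
    have in_U: "x + s *\<^sub>R a + t *\<^sub>R b \<in> U" if "0 \<le> s" "s \<le> h" "0 \<le> t" "t \<le> h" for s t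
      using near[OF that] d3 by (auto simp: d_def dist_commute mem_ball subset_iff)
    obtain s t where st: "0 \<le> s" "s \<le> h" "0 \<le> t" "t \<le> h"
      "f (x + h *\<^sub>R a + h *\<^sub>R b) - f (x + h *\<^sub>R a) - f (x + h *\<^sub>R b) + f x = h * h * ?H a b (x + s *\<^sub>R a + t *\<^sub>R b)"
      using Ck2_mixed_difference[OF assms(1,2) h in_U] by blast
    have in_U': "x + s *\<^sub>R b + t *\<^sub>R a \<in> U" if "0 \<le> s" "s \<le> h" "0 \<le> t" "t \<le> h" for s t
      using in_U[OF that(3,4,1,2)] by (simp add: algebra_simps)
    obtain s' t' where st': "0 \<le> s'" "s' \<le> h" "0 \<le> t'" "t' \<le> h"
      "f (x + h *\<^sub>R b + h *\<^sub>R a) - f (x + h *\<^sub>R b) - f (x + h *\<^sub>R a) + f x = h * h * ?H b a (x + s' *\<^sub>R b + t' *\<^sub>R a)"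
      using Ck2_mixed_difference[OF assms(1,2) h in_U'] by blast
    have "h * h * ?H a b (x + s *\<^sub>R a + t *\<^sub>R b) = h * h * ?H b a (x + s' *\<^sub>R b + t' *\<^sub>R a)"
      using st(5) st'(5) by (simp add: algebra_simps)
    then have eq: "?H a b (x + s *\<^sub>R a + t *\<^sub>R b) = ?H b a (x + t' *\<^sub>R a + s' *\<^sub>R b)"
      using h by (simp add: algebra_simps)
    have "dist (?H a b (x + s *\<^sub>R a + t *\<^sub>R b)) (?H a b x) < e"
      using d1(2) near[OF st(1-4)] by (simp add: d_def)
    moreover have "dist (?H b a (x + t' *\<^sub>R a + s' *\<^sub>R b)) (?H b a x) < e"
      using d2(2) near[OF st'(3,4,1,2)] by (simp add: d_def)
    ultimately have "\<bar>?H a b x - ?H b a x\<bar> < 2 * e" using eq unfolding dist_real_def by linarith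
    then show False by (simp add: e_def)
  qed
qed

section \<open>Power series in several variables\<close>

definition monomial :: "('a::euclidean_space \<Rightarrow> nat) \<Rightarrow> 'a \<Rightarrow> real" where
  "monomial \<alpha> y = (\<Prod>i\<in>Basis. (y \<bullet> i) ^ \<alpha> i)"

definition power_series_on ::
  "'a \<Rightarrow> real \<Rightarrow> (('a::euclidean_space \<Rightarrow> nat) \<Rightarrow> 'b::real_normed_vector) \<Rightarrow> ('a \<Rightarrow> 'b) \<Rightarrow> bool" where
  "power_series_on p r c f \<longleftrightarrow>
     (\<forall>x\<in>ball p r. ((\<lambda>\<alpha>. monomial \<alpha> (x - p) *\<^sub>R c \<alpha>) has_sum f x) multi_indices)"

lemma locally_power_series_iff:
  "locally_power_series U f \<longleftrightarrow> (\<forall>p\<in>U. \<exists>r>0. \<exists>c. power_series_on p r c f)"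
  unfolding locally_power_series_def power_series_on_def monomial_def ..

lemma power_series_on_mono: "power_series_on p r c f \<Longrightarrow> s \<le> r \<Longrightarrow> power_series_on p s c f"
  unfolding power_series_on_def by auto

lemma locally_power_series_zero: "locally_power_series U (\<lambda>x. 0)"
  unfolding locally_power_series_iff power_series_on_def
  by (intro ballI exI[of _ 1] conjI exI[of _ "\<lambda>_. 0"]) auto

text \<open>Two expansions at the same centre are restricted to the smaller ball, so that only the
  combination of coefficients on a common ball is left to each application.\<close>

lemma locally_power_series_combine:
  assumes "locally_power_series U f" "locally_power_series U g"
    and "\<And>p r c d. p \<in> U \<Longrightarrow> r > 0 \<Longrightarrow> power_series_on p r c f \<Longrightarrow> power_series_on p r d g \<Longrightarrow>
      \<exists>e. power_series_on p r e h"
  shows "locally_power_series U h"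
  unfolding locally_power_series_iff
proof
  fix p assume p: "p \<in> U"
  obtain r c where rc: "r > 0" "power_series_on p r c f"
    using assms(1) p unfolding locally_power_series_iff by blast
  obtain s d where sd: "s > 0" "power_series_on p s d g"
    using assms(2) p unfolding locally_power_series_iff by blast
  have "\<exists>e. power_series_on p (min r s) e h"
    by (rule assms(3)[OF p _ power_series_on_mono[OF rc(2)] power_series_on_mono[OF sd(2)]])
      (use rc sd in auto)
  then show "\<exists>r>0. \<exists>c. power_series_on p r c h" using rc sd by (metis min_less_iff_conj)
qed

lemma locally_power_series_add:
  assumes "locally_power_series U f" "locally_power_series U g"
  shows "locally_power_series U (\<lambda>x. f x + g x)"
proof (rule locally_power_series_combine[OF assms])
  fix p r c d assume "power_series_on p r c f" "power_series_on p r d g"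
  then have *: "power_series_on p r (\<lambda>\<alpha>. c \<alpha> + d \<alpha>) (\<lambda>x. f x + g x)"
    unfolding power_series_on_def scaleR_add_right by (intro ballI has_sum_add) auto
  show "\<exists>e. power_series_on p r e (\<lambda>x. f x + g x)" by (rule exI) fact
qed

lemma locally_power_series_linear:
  assumes "bounded_linear h" "locally_power_series U f"
  shows "locally_power_series U (\<lambda>x. h (f x))"
  unfolding locally_power_series_iff
proof
  fix p assume "p \<in> U"
  then obtain r c where rc: "r > 0" "power_series_on p r c f"
    using assms(2) unfolding locally_power_series_iff by blast
  have "power_series_on p r (\<lambda>\<alpha>. h (c \<alpha>)) (\<lambda>x. h (f x))"
    using rc(2) has_sum_bounded_linear[OF assms(1)]
    unfolding power_series_on_def by (fastforce simp: linear_simps(5)[OF assms(1)])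
  then show "\<exists>r>0. \<exists>c. power_series_on p r c (\<lambda>x. h (f x))" using rc by blast
qed

section \<open>Absolute convergence and Cauchy products\<close>

text \<open>Finite dimension enters here: each coordinate is a summable real family, hence
  absolutely summable, and the norm is at most the sum of the absolute coordinates.\<close>

lemma summable_on_imp_abs_summable_on_euclidean:
  fixes f :: "'i \<Rightarrow> 'b::euclidean_space"
  assumes "f summable_on A"
  shows "(\<lambda>x. norm (f x)) summable_on A"
proof (rule Infinite_Sum.abs_summable_on_comparison_test')
  have *: "(\<lambda>x. \<bar>f x \<bullet> b\<bar>) summable_on A" for b
    using summable_on_iff_abs_summable_on_real[THEN iffD1,
        OF summable_on_bounded_linear[OF bounded_linear_inner_left assms, of b]]
    by simp
  have "(\<lambda>x. \<Sum>b\<in>B. \<bar>f x \<bullet> b\<bar>) summable_on A" if "finite B" for B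
    using that by (induction B rule: finite_induct) (auto intro: summable_on_add *)
  then show "(\<lambda>x. \<Sum>b\<in>Basis. \<bar>f x \<bullet> b\<bar>) summable_on A" by simp
qed (rule norm_le_l1)

lemma monomial_add: "monomial (\<lambda>i. \<alpha> i + \<beta> i) y = monomial \<alpha> y * monomial \<beta> y"
  unfolding monomial_def by (simp add: power_add prod.distrib)

text \<open>Makes the coefficients of a product finite sums: both summands are bounded by the
  entries of \<gamma> on the basis and vanish off it.\<close>

lemma finite_multi_index_splittings:
  "finite {(\<alpha>, \<beta>). \<alpha> \<in> multi_indices \<and> \<beta> \<in> multi_indices \<and> (\<lambda>i. \<alpha> i + \<beta> i) = \<gamma>}"
    (is "finite ?S")
proof -
  define N where "N = Max (\<gamma> ` Basis)"
  let ?F = "{\<alpha>::'a \<Rightarrow> nat. \<forall>x. (x \<in> Basis \<longrightarrow> \<alpha> x \<in> {..N}) \<and> (x \<notin> Basis \<longrightarrow> \<alpha> x = 0)}"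
  have "\<alpha> i \<le> N \<and> \<beta> i \<le> N" if "i \<in> Basis" "(\<lambda>i. \<alpha> i + \<beta> i) = \<gamma>" for \<alpha> \<beta> i
  proof -
    have "\<alpha> i + \<beta> i = \<gamma> i" using that(2) by auto
    moreover have "\<gamma> i \<le> N" using that(1) by (simp add: N_def)
    ultimately show ?thesis by simp
  qed
  then have "?S \<subseteq> ?F \<times> ?F" unfolding multi_indices_def by auto
  moreover have "finite (?F \<times> ?F)" by (intro finite_cartesian_product finite_set_of_finite_funs) auto
  ultimately show ?thesis by (rule finite_subset)
qed

text \<open>Summation over \<open>J\<close> gives \<open>B (f i) T\<close>, then over
  \<open>I\<close> gives \<open>B S T\<close>. The double family is summable because its norm is at
  most a constant times \<open>norm (f i) * norm (g j)\<close>, a product of two summable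
  families.\<close>

lemma has_sum_bilinear:
  fixes f :: "'i \<Rightarrow> 'b::euclidean_space" and g :: "'j \<Rightarrow> 'c::euclidean_space"
    and B :: "'b \<Rightarrow> 'c \<Rightarrow> 'd::euclidean_space"
  assumes "bounded_bilinear B" "(f has_sum S) I" "(g has_sum T) J"
  shows "((\<lambda>(i, j). B (f i) (g j)) has_sum B S T) (I \<times> J)"
proof (rule has_sum_SigmaI)
  interpret bounded_bilinear B by fact
  show "((\<lambda>j. (\<lambda>(i, j). B (f i) (g j)) (i, j)) has_sum B (f i) T) J" if "i \<in> I" for i
    using has_sum_bounded_linear[OF bounded_linear_right assms(3)] by simp
  show "((\<lambda>i. B (f i) T) has_sum B S T) I"
    using has_sum_bounded_linear[OF bounded_linear_left assms(2)] by simp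
  obtain K where K: "\<And>a b. norm (B a b) \<le> norm a * norm b * K" using bounded by blast
  have "(\<lambda>i. norm (f i)) summable_on I" "(\<lambda>j. norm (g j)) summable_on J"
    using assms(2,3) summable_on_imp_abs_summable_on_euclidean has_sum_imp_summable by blast+
  then obtain A C where AC: "((\<lambda>i. norm (f i)) has_sum A) I" "((\<lambda>j. norm (g j)) has_sum C) J"
    unfolding summable_on_def by blast
  have "(\<lambda>(i, j). norm (f i) * norm (g j)) summable_on I \<times> J"
  proof (rule summable_on_SigmaI[where g="\<lambda>i. norm (f i) * C"])
    show "((\<lambda>j. (\<lambda>(i, j). norm (f i) * norm (g j)) (i, j)) has_sum norm (f i) * C) J" for i
      using has_sum_cmult_right[OF AC(2)] by simp
    show "(\<lambda>i. norm (f i) * C) summable_on I"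
      using has_sum_cmult_left[OF AC(1)] summable_on_def by blast
  qed auto
  then have "(\<lambda>p. norm (f (fst p)) * norm (g (snd p)) * K) summable_on I \<times> J"
    using summable_on_cmult_left by (simp add: case_prod_unfold)
  then have "(\<lambda>p. norm (B (f (fst p)) (g (snd p)))) summable_on I \<times> J"
    by (rule Infinite_Sum.abs_summable_on_comparison_test') (rule K)
  then show "(\<lambda>(i, j). B (f i) (g j)) summable_on I \<times> J"
    using Infinite_Sum.abs_summable_summable by (simp add: case_prod_unfold)
qed

text \<open>Cauchy product: the double series over pairs of multi-indices is regrouped by the sum of
  the two indices.\<close>

lemma locally_power_series_bilinear:
  fixes f :: "'a::euclidean_space \<Rightarrow> 'b::euclidean_space" and g :: "'a \<Rightarrow> 'c::euclidean_space"
    and B :: "'b \<Rightarrow> 'c \<Rightarrow> 'd::euclidean_space"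
  assumes "bounded_bilinear B" "locally_power_series U f" "locally_power_series U g"
  shows "locally_power_series U (\<lambda>x. B (f x) (g x))"
proof (rule locally_power_series_combine[OF assms(2,3)])
  fix p r c d assume cd: "power_series_on p r c f" "power_series_on p r d g"
  interpret bounded_bilinear B by fact
  let ?S = "\<lambda>\<gamma>. {(\<alpha>, \<beta>). \<alpha> \<in> multi_indices \<and> \<beta> \<in> multi_indices \<and> (\<lambda>i::'a. \<alpha> i + \<beta> i) = \<gamma>}"
  define e where "e \<gamma> = (\<Sum>(\<alpha>, \<beta>)\<in>?S \<gamma>. B (c \<alpha>) (d \<beta>))" for \<gamma>
  have "power_series_on p r e (\<lambda>x. B (f x) (g x))"
    unfolding power_series_on_def
  proof
    fix x assume x: "x \<in> ball p r"
    let ?F = "\<lambda>(\<alpha>, \<beta>). B (monomial \<alpha> (x - p) *\<^sub>R c \<alpha>) (monomial \<beta> (x - p) *\<^sub>R d \<beta>)"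
    have "(?F has_sum B (f x) (g x)) (multi_indices \<times> multi_indices)"
      using cd x unfolding power_series_on_def by (intro has_sum_bilinear[OF assms(1)]) auto
    \<comment> \<open>Each pair is tagged with its sum; \<open>?S \<gamma>\<close> is the finite
      fibre over \<gamma>.\<close>
    also have "?this \<longleftrightarrow> ((\<lambda>(\<gamma>, q). ?F q) has_sum B (f x) (g x)) (Sigma multi_indices ?S)"
      by (rule has_sum_reindex_bij_witness[of _ snd "\<lambda>(\<alpha>, \<beta>). ((\<lambda>i. \<alpha> i + \<beta> i), (\<alpha>, \<beta>))"])
        (auto simp: multi_indices_def)
    finally show "((\<lambda>\<gamma>. monomial \<gamma> (x - p) *\<^sub>R e \<gamma>) has_sum B (f x) (g x)) multi_indices"
    proof (rule has_sum_SigmaD)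
      fix \<gamma> :: "'a \<Rightarrow> nat" assume "\<gamma> \<in> multi_indices"
      have "(\<Sum>q\<in>?S \<gamma>. ?F q) = monomial \<gamma> (x - p) *\<^sub>R e \<gamma>"
        unfolding e_def scaleR_sum_right
        by (intro sum.cong) (auto simp: monomial_add scaleR_left scaleR_right)
      then show "((\<lambda>q. (\<lambda>(\<gamma>, q). ?F q) (\<gamma>, q)) has_sum monomial \<gamma> (x - p) *\<^sub>R e \<gamma>) (?S \<gamma>)"
        using has_sum_finite[OF finite_multi_index_splittings[of \<gamma>], of ?F] by simp
    qed
  qed
  show "\<exists>e. power_series_on p r e (\<lambda>x. B (f x) (g x))" by (rule exI) fact
qed

section \<open>Differentiation of power series term by term\<close>

text \<open>The remainder is \<open>t\<^sup>2\<close> times a polynomial in \<open>s\<close> and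
  \<open>t\<close> with nonnegative coefficients, so passing to \<bar>s\<bar> and \<delta> inside
  the polynomial can only enlarge it. The induction uses the recursion R(n+1) = (s + t) R(n) + n t^2
  s^(n-1), valid for both sides. At \<open>n = 0\<close> the truncated exponent \<open>n - 1\<close>
  is harmless because of the factor \<open>real n\<close>.\<close>

lemma abs_power_remainder_le:
  fixes s t \<delta> :: real
  assumes "\<bar>t\<bar> \<le> \<delta>" "\<delta> > 0"
  shows "\<bar>(s + t) ^ n - s ^ n - real n * t * s ^ (n - 1)\<bar>
    \<le> (t / \<delta>)\<^sup>2 * ((\<bar>s\<bar> + \<delta>) ^ n - \<bar>s\<bar> ^ n - real n * \<delta> * \<bar>s\<bar> ^ (n - 1))"
proof (induction n)
  case (Suc n)
  let ?R = "(s + t) ^ n - s ^ n - real n * t * s ^ (n - 1)"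
  let ?Q = "(\<bar>s\<bar> + \<delta>) ^ n - \<bar>s\<bar> ^ n - real n * \<delta> * \<bar>s\<bar> ^ (n - 1)"
  have *: "real n * x * x ^ (n - 1) = real n * x ^ n" for x :: real
    by (cases n) auto
  have "(s + t) ^ Suc n - s ^ Suc n - real (Suc n) * t * s ^ (Suc n - 1)
    = (s + t) * ?R + real n * t\<^sup>2 * s ^ (n - 1)"
    using *[of s] by (simp add: algebra_simps power2_eq_square)
  also have "\<bar>\<dots>\<bar> \<le> (\<bar>s\<bar> + \<delta>) * \<bar>?R\<bar> + real n * t\<^sup>2 * \<bar>s\<bar> ^ (n - 1)"
  proof -
    have "\<bar>(s + t) * ?R\<bar> \<le> (\<bar>s\<bar> + \<delta>) * \<bar>?R\<bar>"
      unfolding abs_mult using assms by (intro mult_right_mono) auto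
    moreover have "\<bar>real n * t\<^sup>2 * s ^ (n - 1)\<bar> = real n * t\<^sup>2 * \<bar>s\<bar> ^ (n - 1)"
      by (simp add: abs_mult power_abs)
    ultimately show ?thesis by linarith
  qed
  also have "\<dots> \<le> (\<bar>s\<bar> + \<delta>) * ((t / \<delta>)\<^sup>2 * ?Q) + real n * t\<^sup>2 * \<bar>s\<bar> ^ (n - 1)"
    using Suc assms by (intro add_right_mono mult_left_mono) auto
  also have "real n * t\<^sup>2 * \<bar>s\<bar> ^ (n - 1) = (t / \<delta>)\<^sup>2 * (real n * \<delta>\<^sup>2 * \<bar>s\<bar> ^ (n - 1))"
    using assms by (simp add: power_divide)
  also have "(\<bar>s\<bar> + \<delta>) * ((t / \<delta>)\<^sup>2 * ?Q) + (t / \<delta>)\<^sup>2 * (real n * \<delta>\<^sup>2 * \<bar>s\<bar> ^ (n - 1))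
    = (t / \<delta>)\<^sup>2 * ((\<bar>s\<bar> + \<delta>) * ?Q + real n * \<delta>\<^sup>2 * \<bar>s\<bar> ^ (n - 1))"
    by (simp add: algebra_simps)
  also have "(\<bar>s\<bar> + \<delta>) * ?Q + real n * \<delta>\<^sup>2 * \<bar>s\<bar> ^ (n - 1)
    = (\<bar>s\<bar> + \<delta>) ^ Suc n - \<bar>s\<bar> ^ Suc n - real (Suc n) * \<delta> * \<bar>s\<bar> ^ (Suc n - 1)"
    by (cases n) (simp_all add: algebra_simps power2_eq_square)
  finally show ?case .
qed auto

lemma monomial_remove:
  assumes "j \<in> Basis"
  shows "monomial \<alpha> y = (y \<bullet> j) ^ \<alpha> j * (\<Prod>i\<in>Basis - {j}. (y \<bullet> i) ^ \<alpha> i)"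
  unfolding monomial_def by (simp add: prod.remove[OF _ assms])

text \<open>Along the line through \<open>x\<close> in direction \<open>v\<close> both
  \<open>D v\<close> and \<open>S\<close> are derivatives at 0, since a quadratic remainder is o(t);
  derivatives in one real variable are unique.\<close>

lemma has_derivative_eq_partialI:
  fixes f :: "'a::real_normed_vector \<Rightarrow> 'b::real_normed_vector"
  assumes "(f has_derivative D) (at x)" "\<delta> > 0"
    and "\<And>t. \<bar>t\<bar> \<le> \<delta> \<Longrightarrow> norm (f (x + t *\<^sub>R v) - f x - t *\<^sub>R S) \<le> C * t\<^sup>2"
  shows "D v = S"
proof -
  let ?g = "\<lambda>t. f (x + t *\<^sub>R v)"
  have "(?g has_derivative (\<lambda>t. D (t *\<^sub>R v))) (at 0)"
    by (rule has_derivative_compose[where g=f and f="\<lambda>t. x + t *\<^sub>R v"])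
      (use assms(1) in \<open>auto intro!: derivative_eq_intros\<close>)
  moreover have "(?g has_derivative (\<lambda>t. t *\<^sub>R S)) (at 0)"
    unfolding has_derivative_at
  proof
    show "(\<lambda>h. norm (f (x + (0 + h) *\<^sub>R v) - f (x + 0 *\<^sub>R v) - h *\<^sub>R S) / norm h) \<midarrow>0\<rightarrow> 0"
    proof (rule tendsto_sandwich[where f="\<lambda>_. 0" and h="\<lambda>h. C * \<bar>h\<bar>"])
      show "\<forall>\<^sub>F h in at 0. norm (f (x + (0 + h) *\<^sub>R v) - f (x + 0 *\<^sub>R v) - h *\<^sub>R S) / norm h \<le> C * \<bar>h\<bar>"
        unfolding eventually_at
      proof (intro exI[of _ \<delta>] conjI ballI impI)
        fix h :: real assume h: "h \<noteq> 0 \<and> dist h 0 < \<delta>"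
        then have "norm (f (x + h *\<^sub>R v) - f x - h *\<^sub>R S) \<le> C * h\<^sup>2" by (intro assms(3)) simp
        then show "norm (f (x + (0 + h) *\<^sub>R v) - f (x + 0 *\<^sub>R v) - h *\<^sub>R S) / norm h \<le> C * \<bar>h\<bar>"
          using h by (simp add: divide_le_eq power2_eq_square abs_mult_self_eq mult.assoc)
      qed (use assms(2) in auto)
      show "((\<lambda>h. C * \<bar>h\<bar>) \<longlongrightarrow> 0) (at (0::real))" by (auto intro!: tendsto_eq_intros)
    qed auto
  qed (simp add: bounded_linear_scaleR_left)
  ultimately have "(\<lambda>t. D (t *\<^sub>R v)) = (\<lambda>t. t *\<^sub>R S)" by (rule has_derivative_unique)
  from fun_cong[OF this, of 1] show ?thesis by simp
qed

lemma has_sum_diff_real_normed_vector: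
  fixes f g :: "'i \<Rightarrow> 'b::real_normed_vector"
  assumes "(f has_sum a) A" "(g has_sum b) A"
  shows "((\<lambda>x. f x - g x) has_sum (a - b)) A"
  using has_sum_add[OF assms(1), of "\<lambda>x. - g x" "- b"] assms(2) by (simp add: has_sum_uminus)

text \<open>The series converges absolutely at the point all of whose coordinates relative to
  \<open>p\<close> equal \<open>R\<close>; the norms of its terms there are the majorant. Dividing
  \<open>r\<close> by twice the dimension keeps this point within distance \<open>r / 2\<close> of
  \<open>p\<close>.\<close>

lemma power_series_on_majorant:
  fixes f :: "'a::euclidean_space \<Rightarrow> 'b::euclidean_space"
  assumes "power_series_on p r c f" "r > 0"
  obtains R where "0 < R" "R \<le> r"
    "(\<lambda>\<alpha>. (\<Prod>i\<in>Basis. R ^ \<alpha> i) * norm (c \<alpha>)) summable_on multi_indices"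
proof
  define R where "R = r / (2 * DIM('a))"
  have n: "1 \<le> 2 * real DIM('a)"
    using of_nat_mono[OF DIM_ge_Suc0[where 'a='a], where 'a=real] by linarith
  show R: "0 < R" using assms(2) by (simp add: R_def)
  show "R \<le> r" unfolding R_def using assms(2) n by (simp add: divide_le_eq)
  define y :: 'a where "y = (\<Sum>i\<in>Basis. R *\<^sub>R i)"
  have yi: "y \<bullet> i = R" if "i \<in> Basis" for i
    using that unfolding y_def by (simp add: inner_sum_left inner_Basis if_distrib cong: if_cong)
  have "norm y \<le> (\<Sum>i\<in>(Basis::'a set). R)"
    using norm_le_l1[of y] yi R by simp
  also have "\<dots> = r / 2" by (simp add: R_def)
  finally have "p + y \<in> ball p r" using assms(2) by (simp add: dist_norm)
  then have "(\<lambda>\<alpha>. monomial \<alpha> y *\<^sub>R c \<alpha>) summable_on multi_indices"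
    using assms(1) unfolding power_series_on_def by (metis add_diff_cancel_left' has_sum_imp_summable)
  then have "(\<lambda>\<alpha>. norm (monomial \<alpha> y *\<^sub>R c \<alpha>)) summable_on multi_indices"
    by (rule summable_on_imp_abs_summable_on_euclidean)
  moreover have "monomial \<alpha> y = (\<Prod>i\<in>Basis. R ^ \<alpha> i)" for \<alpha>
    unfolding monomial_def using yi by simp
  moreover have "(\<Prod>i\<in>(Basis::'a set). R ^ \<alpha> i) \<ge> 0" for \<alpha>
    using R by (simp add: prod_nonneg)
  ultimately show "(\<lambda>\<alpha>. (\<Prod>i\<in>(Basis::'a set). R ^ \<alpha> i) * norm (c \<alpha>)) summable_on multi_indices"
    by simp
qed

text \<open>On the ball of radius \<delta> the second-order remainder in direction \<open>j\<close>
  of the term of index \<alpha> is at most \<open>(t / \<delta>)\<^sup>2 * M \<alpha>\<close>.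
  Summed over \<alpha> this is a quadratic remainder for \<open>f\<close>, which identifies
  \<open>D x j\<close> with the sum of the formal derivative. Differentiability being a hypothesis,
  only the value of the derivative is at issue.\<close>

lemma power_series_on_partial:
  fixes f :: "'a::euclidean_space \<Rightarrow> 'b::euclidean_space"
  assumes "power_series_on p r c f" "r > 0" "j \<in> Basis"
    and "\<And>x. x \<in> ball p r \<Longrightarrow> (f has_derivative D x) (at x)"
  shows "\<exists>s>0. \<exists>d. power_series_on p s d (\<lambda>x. D x j)"
proof -
  obtain R where R: "0 < R" "R \<le> r"
    "(\<lambda>\<alpha>. (\<Prod>i\<in>Basis. R ^ \<alpha> i) * norm (c \<alpha>)) summable_on multi_indices"
    using power_series_on_majorant[OF assms(1,2)] .
  define M where "M \<alpha> = (\<Prod>i\<in>Basis. R ^ \<alpha> i) * norm (c \<alpha>)" for \<alpha>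
  define \<delta> where "\<delta> = R / 2"
  have \<delta>: "\<delta> > 0" using R by (simp add: \<delta>_def)
  obtain C where C: "(M has_sum C) multi_indices"
    using R(3) unfolding M_def summable_on_def by blast
  \<comment> \<open>Coefficients of the formal partial derivative: the monomial \<beta> arises from
    the term whose exponent of \<open>j\<close> is one higher.\<close>
  define d where "d \<beta> = real (Suc (\<beta> j)) *\<^sub>R c (\<beta>(j := Suc (\<beta> j)))" for \<beta>
  have "power_series_on p \<delta> d (\<lambda>x. D x j)"
    unfolding power_series_on_def
  proof
    fix x assume x: "x \<in> ball p \<delta>"
    \<comment> \<open>The monomial is split into a power of its \<open>j\<close>-th coordinate
      \<open>s\<close> and the remaining factor \<open>m \<alpha>\<close>; \<open>E \<alpha>\<close>
      is the \<open>j\<close>-th partial derivative at \<open>x\<close> of the term of index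
      \<alpha>.\<close>
    define s where "s = (x - p) \<bullet> j"
    define m where "m \<alpha> = (\<Prod>i\<in>Basis - {j}. ((x - p) \<bullet> i) ^ \<alpha> i)" for \<alpha>
    define E where "E \<alpha> = (real (\<alpha> j) * s ^ (\<alpha> j - 1) * m \<alpha>) *\<^sub>R c \<alpha>" for \<alpha>
    have coord: "\<bar>(x - p) \<bullet> i\<bar> \<le> \<delta>" if "i \<in> Basis" for i
      using Basis_le_norm[OF that, of "x - p"] x by (simp add: dist_norm norm_minus_commute)
    have coord_R: "\<bar>(x - p) \<bullet> i\<bar> \<le> R" if "i \<in> Basis" for i
      using coord[OF that] R(1) unfolding \<delta>_def by linarith
    have s: "\<bar>s\<bar> + \<delta> \<le> R" using coord[OF assms(3)] by (simp add: s_def \<delta>_def)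
    have m: "\<bar>m \<alpha>\<bar> \<le> (\<Prod>i\<in>Basis - {j}. R ^ \<alpha> i)" for \<alpha>
      unfolding m_def abs_prod power_abs using coord_R
      by (intro prod_mono) (auto intro!: power_mono)
    have M: "M \<alpha> = R ^ \<alpha> j * (\<Prod>i\<in>Basis - {j}. R ^ \<alpha> i) * norm (c \<alpha>)" for \<alpha>
      unfolding M_def by (simp add: prod.remove[OF _ assms(3)])
    \<comment> \<open>Since \<open>\<bar>s\<bar> + \<delta> \<le> R\<close>, a factor controlled by
      a power of \<open>\<bar>s\<bar> + \<delta>\<close> becomes a multiple of the majorant. Used
      with \<open>K = 1 / \<delta>\<close> for \<open>E\<close> and with
      \<open>K = (t / \<delta>)\<^sup>2\<close> for the remainder.\<close>
    have bound: "norm ((u * m \<alpha>) *\<^sub>R c \<alpha>) \<le> K * M \<alpha>" if "\<bar>u\<bar> \<le> K * (\<bar>s\<bar> + \<delta>) ^ \<alpha> j" "K \<ge> 0" for u K \<alpha>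
    proof -
      have "\<bar>u\<bar> \<le> K * R ^ \<alpha> j"
        by (rule order.trans[OF that(1)]) (use that(2) s \<delta> in \<open>auto intro!: mult_left_mono power_mono\<close>)
      then have "\<bar>u\<bar> * \<bar>m \<alpha>\<bar> \<le> (K * R ^ \<alpha> j) * (\<Prod>i\<in>Basis - {j}. R ^ \<alpha> i)"
        using m R(1) that(2) by (intro mult_mono) auto
      then have "\<bar>u\<bar> * \<bar>m \<alpha>\<bar> * norm (c \<alpha>) \<le> (K * R ^ \<alpha> j) * (\<Prod>i\<in>Basis - {j}. R ^ \<alpha> i) * norm (c \<alpha>)"
        by (rule mult_right_mono) simp
      then show ?thesis by (simp add: M abs_mult mult.assoc)
    qed
    have "E summable_on multi_indices"
    proof (rule Infinite_Sum.abs_summable_summable, rule Infinite_Sum.abs_summable_on_comparison_test')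
      show "(\<lambda>\<alpha>. (1 / \<delta>) * M \<alpha>) summable_on multi_indices"
        using R(3) unfolding M_def by (rule summable_on_cmult_right)
      show "norm (E \<alpha>) \<le> (1 / \<delta>) * M \<alpha>" for \<alpha>
        unfolding E_def
      proof (rule bound)
        \<comment> \<open>The remainder bound with \<open>t = \<delta>\<close> says that its own
          right-hand side is nonnegative.\<close>
        have "real (\<alpha> j) * \<delta> * \<bar>s\<bar> ^ (\<alpha> j - 1) \<le> (\<bar>s\<bar> + \<delta>) ^ \<alpha> j - \<bar>s\<bar> ^ \<alpha> j"
          using order.trans[OF abs_ge_zero abs_power_remainder_le[of \<delta> \<delta> s "\<alpha> j"]] \<delta> by simp
        moreover have "real (\<alpha> j) * \<bar>s\<bar> ^ (\<alpha> j - 1) * \<delta> = real (\<alpha> j) * \<delta> * \<bar>s\<bar> ^ (\<alpha> j - 1)"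
          by simp
        ultimately have "real (\<alpha> j) * \<bar>s\<bar> ^ (\<alpha> j - 1) * \<delta> \<le> (\<bar>s\<bar> + \<delta>) ^ \<alpha> j"
          using zero_le_power[OF abs_ge_zero, of s "\<alpha> j"] by linarith
        then show "\<bar>real (\<alpha> j) * s ^ (\<alpha> j - 1)\<bar> \<le> 1 / \<delta> * (\<bar>s\<bar> + \<delta>) ^ \<alpha> j"
          using \<delta> by (simp add: abs_mult power_abs le_divide_eq)
      qed (use \<delta> in simp)
    qed
    then obtain S where S: "(E has_sum S) multi_indices" unfolding summable_on_def by blast
    have expand: "((\<lambda>\<alpha>. ((s + t) ^ \<alpha> j * m \<alpha>) *\<^sub>R c \<alpha>) has_sum f (x + t *\<^sub>R j)) multi_indices"
      if "\<bar>t\<bar> \<le> \<delta>" for t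
    proof -
      have "norm (x + t *\<^sub>R j - p) \<le> norm (x - p) + norm (t *\<^sub>R j)"
        by (metis add_diff_eq add.commute norm_triangle_ineq)
      also have "\<dots> < R" using x that assms(3) by (simp add: dist_norm norm_minus_commute \<delta>_def)
      finally have "x + t *\<^sub>R j \<in> ball p r" using R(2) by (simp add: dist_norm norm_minus_commute)
      then have "((\<lambda>\<alpha>. monomial \<alpha> (x + t *\<^sub>R j - p) *\<^sub>R c \<alpha>) has_sum f (x + t *\<^sub>R j)) multi_indices"
        using assms(1) unfolding power_series_on_def by blast
      moreover have "monomial \<alpha> (x + t *\<^sub>R j - p) = (s + t) ^ \<alpha> j * m \<alpha>" for \<alpha>
      proof -
        have "(x + t *\<^sub>R j - p) \<bullet> i = (x - p) \<bullet> i" if "i \<in> Basis - {j}" for i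
          using that assms(3) by (auto simp: inner_diff_left inner_add_left inner_Basis)
        moreover have "(x + t *\<^sub>R j - p) \<bullet> j = s + t"
          using assms(3) by (simp add: s_def inner_diff_left inner_add_left)
        ultimately show ?thesis
          unfolding monomial_remove[OF assms(3)] m_def by simp
      qed
      ultimately show ?thesis by simp
    qed
    have "D x j = S"
    proof (rule has_derivative_eq_partialI[OF assms(4) \<delta>])
      show "x \<in> ball p r" using x R by (auto simp: \<delta>_def)
      fix t :: real assume t: "\<bar>t\<bar> \<le> \<delta>"
      let ?T = "\<lambda>\<alpha>. ((s + t) ^ \<alpha> j * m \<alpha>) *\<^sub>R c \<alpha> - (s ^ \<alpha> j * m \<alpha>) *\<^sub>R c \<alpha> - t *\<^sub>R E \<alpha>"
      have "(?T has_sum (f (x + t *\<^sub>R j) - f x - t *\<^sub>R S)) multi_indices"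
        using expand[OF t] expand[of 0] \<delta> S
        by (intro has_sum_diff_real_normed_vector has_sum_scaleR) auto
      moreover have "((\<lambda>\<alpha>. (t / \<delta>)\<^sup>2 * M \<alpha>) has_sum (t / \<delta>)\<^sup>2 * C) multi_indices"
        by (rule has_sum_cmult_right[OF C])
      moreover have "norm (?T \<alpha>) \<le> (t / \<delta>)\<^sup>2 * M \<alpha>" for \<alpha>
      proof -
        have "?T \<alpha> = (((s + t) ^ \<alpha> j - s ^ \<alpha> j - real (\<alpha> j) * t * s ^ (\<alpha> j - 1)) * m \<alpha>) *\<^sub>R c \<alpha>"
          unfolding E_def by (simp add: algebra_simps)
        also have "norm \<dots> \<le> (t / \<delta>)\<^sup>2 * M \<alpha>"
        proof (rule bound)
          have "(\<bar>s\<bar> + \<delta>) ^ \<alpha> j - \<bar>s\<bar> ^ \<alpha> j - real (\<alpha> j) * \<delta> * \<bar>s\<bar> ^ (\<alpha> j - 1) \<le> (\<bar>s\<bar> + \<delta>) ^ \<alpha> j"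
          proof -
            have "0 \<le> real (\<alpha> j) * \<delta> * \<bar>s\<bar> ^ (\<alpha> j - 1)" "0 \<le> \<bar>s\<bar> ^ \<alpha> j" using \<delta> by simp_all
            then show ?thesis by linarith
          qed
          then show "\<bar>(s + t) ^ \<alpha> j - s ^ \<alpha> j - real (\<alpha> j) * t * s ^ (\<alpha> j - 1)\<bar>
            \<le> (t / \<delta>)\<^sup>2 * (\<bar>s\<bar> + \<delta>) ^ \<alpha> j"
            by (intro order.trans[OF abs_power_remainder_le[OF t \<delta>]] mult_left_mono) auto
        qed simp
        finally show ?thesis .
      qed
      ultimately have "norm (f (x + t *\<^sub>R j) - f x - t *\<^sub>R S) \<le> (t / \<delta>)\<^sup>2 * C"
        by (rule norm_infsum_le)
      then show "norm (f (x + t *\<^sub>R j) - f x - t *\<^sub>R S) \<le> (C / \<delta>\<^sup>2) * t\<^sup>2"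
        by (simp add: power_divide mult.commute)
    qed
    \<comment> \<open>Terms with \<open>\<alpha> j = 0\<close> vanish; on the others, lowering the
      exponent of \<open>j\<close> by one is a bijection onto all multi-indices.\<close>
    moreover have "(E has_sum S) multi_indices \<longleftrightarrow> (E has_sum S) {\<alpha> \<in> multi_indices. \<alpha> j \<noteq> 0}"
      by (rule has_sum_cong_neutral) (auto simp: E_def)
    moreover have "((\<lambda>\<beta>. monomial \<beta> (x - p) *\<^sub>R d \<beta>) has_sum S) multi_indices
      \<longleftrightarrow> (E has_sum S) {\<alpha> \<in> multi_indices. \<alpha> j \<noteq> 0}"
    proof (rule has_sum_reindex_bij_witness[of _ "\<lambda>\<alpha>. \<alpha>(j := \<alpha> j - 1)" "\<lambda>\<beta>. \<beta>(j := Suc (\<beta> j))"])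
      fix \<beta> :: "'a \<Rightarrow> nat"
      have "m (\<beta>(j := Suc (\<beta> j))) = m \<beta>" unfolding m_def by (intro prod.cong) auto
      then show "E (\<beta>(j := Suc (\<beta> j))) = monomial \<beta> (x - p) *\<^sub>R d \<beta>"
        unfolding E_def d_def monomial_remove[OF assms(3)] by (simp add: s_def m_def algebra_simps)
    qed (use assms(3) in \<open>auto simp: multi_indices_def\<close>)
    ultimately show "((\<lambda>\<beta>. monomial \<beta> (x - p) *\<^sub>R d \<beta>) has_sum D x j) multi_indices"
      using S by simp
  qed
  then show ?thesis using \<delta> by blast
qed


lemma locally_power_series_sum:
  assumes "\<And>i. i \<in> I \<Longrightarrow> locally_power_series U (f i)"
  shows "locally_power_series U (\<lambda>x. \<Sum>i\<in>I. f i x)"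
  using assms
  by (induction I rule: infinite_finite_induct)
    (auto intro: locally_power_series_zero locally_power_series_add)

lemma locally_power_series_cong:
  assumes "open U" "\<And>x. x \<in> U \<Longrightarrow> f x = g x" "locally_power_series U f"
  shows "locally_power_series U g"
  unfolding locally_power_series_iff
proof
  fix p assume p: "p \<in> U"
  obtain r c where rc: "r > 0" "power_series_on p r c f"
    using assms(3) p unfolding locally_power_series_iff by blast
  obtain e where e: "e > 0" "ball p e \<subseteq> U" using assms(1) p open_contains_ball by blast
  have "power_series_on p (min r e) c g"
    unfolding power_series_on_def
  proof
    fix x assume x: "x \<in> ball p (min r e)"
    then have "((\<lambda>\<alpha>. monomial \<alpha> (x - p) *\<^sub>R c \<alpha>) has_sum f x) multi_indices"
      using rc(2) unfolding power_series_on_def by auto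
    moreover have "f x = g x" using x e(2) by (intro assms(2)) auto
    ultimately show "((\<lambda>\<alpha>. monomial \<alpha> (x - p) *\<^sub>R c \<alpha>) has_sum g x) multi_indices" by simp
  qed
  then show "\<exists>r>0. \<exists>c. power_series_on p r c g" using rc e by (metis min_less_iff_conj)
qed

lemma linear_eq_sum_Basis:
  fixes D :: "'a::euclidean_space \<Rightarrow> 'b::real_vector"
  assumes "linear D"
  shows "D v = (\<Sum>j\<in>Basis. (v \<bullet> j) *\<^sub>R D j)"
  by (subst euclidean_representation[of v, symmetric])
    (simp add: linear_sum[OF assms] linear_cmul[OF assms])

lemma locally_power_series_derivative:
  fixes f :: "'a::euclidean_space \<Rightarrow> 'b::euclidean_space"
  assumes "open U" "locally_power_series U f" "\<And>x. x \<in> U \<Longrightarrow> (f has_derivative D x) (at x)"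
  shows "locally_power_series U (\<lambda>x. D x v)"
proof (rule locally_power_series_cong[OF assms(1)])
  show "locally_power_series U (\<lambda>x. \<Sum>j\<in>Basis. (v \<bullet> j) *\<^sub>R D x j)"
  proof (intro locally_power_series_sum locally_power_series_linear[OF bounded_linear_scaleR_right])
    fix j :: 'a assume j: "j \<in> Basis"
    show "locally_power_series U (\<lambda>x. D x j)"
      unfolding locally_power_series_iff
    proof
      fix p assume p: "p \<in> U"
      obtain r c where rc: "r > 0" "power_series_on p r c f"
        using assms(2) p unfolding locally_power_series_iff by blast
      obtain e where e: "e > 0" "ball p e \<subseteq> U" using assms(1) p open_contains_ball by blast
      have "power_series_on p (min r e) c f" by (rule power_series_on_mono[OF rc(2)]) simp
      then show "\<exists>r>0. \<exists>c. power_series_on p r c (\<lambda>x. D x j)"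
        by (rule power_series_on_partial[OF _ _ j assms(3)]) (use rc(1) e in auto)
    qed
  qed
  show "(\<Sum>j\<in>Basis. (v \<bullet> j) *\<^sub>R D x j) = D x v" if "x \<in> U" for x
    using linear_eq_sum_Basis[OF has_derivative_linear[OF assms(3)[OF that]]] by metis
qed

section \<open>Closure properties of the regularity classes\<close>

lemma of_class_lower: "of_class r U f \<Longrightarrow> of_class (lower r j) U f"
  by (cases r) (auto intro: Ck_on_mono)

lemma of_class_zero: "open U \<Longrightarrow> of_class r U (\<lambda>x. 0)"
  by (cases r) (auto intro: Ck_on_const locally_power_series_zero)

lemma of_class_add:
  "open U \<Longrightarrow> of_class r U f \<Longrightarrow> of_class r U g \<Longrightarrow> of_class r U (\<lambda>x. f x + g x)"
  by (cases r) (auto intro: Ck_on_add locally_power_series_add)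

lemma of_class_sum:
  assumes "open U" "\<And>i. i \<in> I \<Longrightarrow> of_class r U (f i)"
  shows "of_class r U (\<lambda>x. \<Sum>i\<in>I. f i x)"
  using assms(2)
  by (induction I rule: infinite_finite_induct) (auto intro: of_class_zero of_class_add assms(1))

lemma of_class_linear:
  "open U \<Longrightarrow> bounded_linear h \<Longrightarrow> of_class r U f \<Longrightarrow> of_class r U (\<lambda>x. h (f x))"
  by (cases r) (auto intro: Ck_on_linear locally_power_series_linear)

lemma of_class_bilinear:
  fixes f :: "'a::euclidean_space \<Rightarrow> 'b::euclidean_space" and g :: "'a \<Rightarrow> 'c::euclidean_space"
    and B :: "'b \<Rightarrow> 'c \<Rightarrow> 'd::euclidean_space"
  shows "open U \<Longrightarrow> bounded_bilinear B \<Longrightarrow> of_class r U f \<Longrightarrow> of_class r U g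
    \<Longrightarrow> of_class r U (\<lambda>x. B (f x) (g x))"
  by (cases r) (auto intro: Ck_on_bilinear locally_power_series_bilinear)

lemma of_class_cong:
  "open U \<Longrightarrow> (\<And>x. x \<in> U \<Longrightarrow> f x = g x) \<Longrightarrow> of_class r U f \<Longrightarrow> of_class r U g"
  by (cases r) (auto intro: Ck_on_cong locally_power_series_cong)

lemma of_class_has_derivative:
  assumes "of_class r U f" "r \<noteq> Ck 0" "x \<in> U"
  shows "(f has_derivative frechet_derivative f (at x)) (at x)"
proof -
  have "Ck_on 1 U f"
  proof (cases r)
    case (Ck k)
    then have "Ck_on k U f" "1 \<le> k" using assms by auto
    then show ?thesis by (rule Ck_on_mono)
  qed (use assms in auto)
  then show ?thesis using Ck_on_SucD(1)[of 0 U f x] assms(3) by simp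
qed

text \<open>By truncated subtraction \<open>lower (Ck 0) 1\<close> is \<open>Ck 0\<close> again,
  hence the restriction on \<open>r\<close>.\<close>

lemma of_class_derivative:
  fixes f :: "'a::euclidean_space \<Rightarrow> 'b::euclidean_space"
  assumes "open U" "of_class r U f" "r \<noteq> Ck 0"
  shows "of_class (lower r 1) U (\<lambda>x. frechet_derivative f (at x) v)"
proof (cases r)
  case (Ck k)
  then obtain j where "k = Suc j" using assms(3) by (cases k) auto
  then show ?thesis using assms Ck by simp
next
  case Cinf
  then have "Ck_on (Suc k) U f" for k using assms(2) by (simp del: Ck_on.simps)
  from Ck_on_SucD(2)[OF this] show ?thesis using Cinf by simp
next
  case Comega
  then have "locally_power_series U f" using assms(2) by simp
  from locally_power_series_derivative[OF assms(1) this of_class_has_derivative[OF assms(2,3)]]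
  have "locally_power_series U (\<lambda>x. frechet_derivative f (at x) v)" .
  moreover have "Ck_on (Suc k) U f" for k using Comega assms(2) by (simp del: Ck_on.simps)
  from Ck_on_SucD(2)[OF this] have "\<forall>k. Ck_on k U (\<lambda>x. frechet_derivative f (at x) v)" by simp
  ultimately show ?thesis using Comega by simp
qed

text \<open>The direction varies with the point, so the derivative is expanded in the basis into
  products of coordinates of \<open>g\<close> with partial derivatives of \<open>f\<close>. The
  terms of a bracket have this form.\<close>

lemma of_class_derivative_along:
  fixes f :: "'a::euclidean_space \<Rightarrow> 'b::euclidean_space"
  assumes "open U" "of_class r U f" "r \<noteq> Ck 0" "of_class (lower r 1) U g"
  shows "of_class (lower r 1) U (\<lambda>x. frechet_derivative f (at x) (g x))"
proof (rule of_class_cong[OF assms(1)])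
  show "of_class (lower r 1) U (\<lambda>x. \<Sum>j\<in>Basis. (g x \<bullet> j) *\<^sub>R frechet_derivative f (at x) j)"
    by (intro of_class_sum of_class_bilinear[OF _ bounded_bilinear_scaleR] of_class_derivative
        of_class_linear[OF _ bounded_linear_inner_left] assms)
  show "(\<Sum>j\<in>Basis. (g x \<bullet> j) *\<^sub>R frechet_derivative f (at x) j) = frechet_derivative f (at x) (g x)"
    if "x \<in> U" for x
    using linear_eq_sum_Basis[OF has_derivative_linear[OF of_class_has_derivative[OF assms(2,3) that]]]
    by metis
qed

section \<open>The matrix group\<close>

lemma exhaust_5: "(x::5) = 1 \<or> x = 2 \<or> x = 3 \<or> x = 4 \<or> x = 5"
proof (induct x)
  case (of_int z)
  \<comment> \<open>In the type \<open>5\<close> the numeral 5 equals 0, so \<open>z = 0\<close> is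
    the case \<open>x = 5\<close>.\<close>
  then have "z = 0 \<or> z = 1 \<or> z = 2 \<or> z = 3 \<or> z = 4" by fastforce
  then show ?case by auto
qed

lemma forall_5: "(\<forall>i::5. P i) \<longleftrightarrow> P 1 \<and> P 2 \<and> P 3 \<and> P 4 \<and> P 5"
  by (metis exhaust_5)

lemma UNIV_5: "UNIV = {1, 2, 3, 4, 5::5}"
  using exhaust_5 by auto

lemma sum_5: "sum f (UNIV::5 set) = f 1 + f 2 + f 3 + f 4 + f 5"
  unfolding UNIV_5 by (simp add: ac_simps)

lemma vector_5 [simp]:
  "(vector [a, b, c, d, e] :: 'a::zero ^ 5) $ 1 = a"
  "(vector [a, b, c, d, e] :: 'a::zero ^ 5) $ 2 = b"
  "(vector [a, b, c, d, e] :: 'a::zero ^ 5) $ 3 = c"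
  "(vector [a, b, c, d, e] :: 'a::zero ^ 5) $ 4 = d"
  "(vector [a, b, c, d, e] :: 'a::zero ^ 5) $ 5 = e"
  unfolding vector_def by simp_all

definition IV2_matrix :: "complex \<Rightarrow> complex \<Rightarrow> complex \<Rightarrow> complex \<Rightarrow> complex \<Rightarrow> complex ^ 5 ^ 5" where
  "IV2_matrix a b c d e =
     vector [vector [c, 0, 0, 0, 0],
             vector [b, a, 0, 0, 0],
             vector [0, 0, cnj c, 0, 0],
             vector [0, 0, cnj b, cnj a, 0],
             vector [e, d, cnj e, cnj d, a * cnj a]]"

lemma IV2_matrix_nth [simp]:
  "IV2_matrix a b c d e $ 1 = vector [c, 0, 0, 0, 0]"
  "IV2_matrix a b c d e $ 2 = vector [b, a, 0, 0, 0]"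
  "IV2_matrix a b c d e $ 3 = vector [0, 0, cnj c, 0, 0]"
  "IV2_matrix a b c d e $ 4 = vector [0, 0, cnj b, cnj a, 0]"
  "IV2_matrix a b c d e $ 5 = vector [e, d, cnj e, cnj d, a * cnj a]"
  unfolding IV2_matrix_def by simp_all

lemma G_IV2_initial_iff:
  "A \<in> G_IV2_initial \<longleftrightarrow> (\<exists>a b c d e. A = IV2_matrix a b c d e \<and> a \<noteq> 0 \<and> c \<noteq> 0)"
  unfolding G_IV2_initial_def IV2_matrix_def by auto

lemma IV2_matrix_mult:
  "IV2_matrix a b c d e ** IV2_matrix a' b' c' d' e' =
     IV2_matrix (a * a') (b * c' + a * b') (c * c')
       (d * a' + a * cnj a * d') (e * c' + d * b' + a * cnj a * e')"
  by (simp add: vec_eq_iff forall_5 matrix_matrix_mult_def sum_5 algebra_simps)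

lemma IV2_matrix_one: "IV2_matrix 1 0 1 0 0 = mat 1"
  by (simp add: vec_eq_iff forall_5 mat_def)

text \<open>The entries solve the equations of \<open>IV2_matrix_mult\<close> for the parameters of
  the identity: first those for the diagonal, then \<open>b'\<close> and \<open>d'\<close>, and last
  \<open>e'\<close>.\<close>

lemma IV2_matrix_right_inverse:
  assumes "a \<noteq> 0" "c \<noteq> 0"
  shows "IV2_matrix a b c d e ** IV2_matrix (1 / a) (- b / (a * c)) (1 / c)
    (- d / (a * a * cnj a)) ((d * b / a - e) / (c * (a * cnj a))) = mat 1"
proof -
  have "a * (1 / a) = 1" "b * (1 / c) + a * (- b / (a * c)) = 0" "c * (1 / c) = 1"
    "d * (1 / a) + a * cnj a * (- d / (a * a * cnj a)) = 0"
    "e * (1 / c) + d * (- b / (a * c)) + a * cnj a * ((d * b / a - e) / (c * (a * cnj a))) = 0"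
    using assms by (simp_all add: field_simps)
  then show ?thesis unfolding IV2_matrix_mult IV2_matrix_one[symmetric] by (simp only:)
qed

lemma group_GL5: "group GL5"
proof (rule groupI)
  fix A assume A: "A \<in> carrier GL5"
  then obtain B where "A ** B = mat 1" "B ** A = mat 1" unfolding GL5_def invertible_def by auto
  then show "\<exists>B\<in>carrier GL5. B \<otimes>\<^bsub>GL5\<^esub> A = \<one>\<^bsub>GL5\<^esub>"
    by (intro bexI[of _ B]) (auto simp: GL5_def invertible_def)
next
  show "\<one>\<^bsub>GL5\<^esub> \<in> carrier GL5" by (auto simp: GL5_def invertible_def intro!: exI[of _ "mat 1"])
qed (auto simp: GL5_def invertible_mult matrix_mul_assoc)

lemma G_IV2_initial_invertible: "A \<in> G_IV2_initial \<Longrightarrow> invertible A"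
  using IV2_matrix_right_inverse unfolding G_IV2_initial_iff invertible_right_inverse by blast

lemma subgroup_G_IV2_initial: "subgroup G_IV2_initial GL5"
proof (rule group.subgroupI[OF group_GL5])
  show "G_IV2_initial \<subseteq> carrier GL5" using G_IV2_initial_invertible by (auto simp: GL5_def)
  show "G_IV2_initial \<noteq> {}" unfolding G_IV2_initial_def by blast
next
  fix A assume A: "A \<in> G_IV2_initial"
  then obtain a b c d e where *: "A = IV2_matrix a b c d e" "a \<noteq> 0" "c \<noteq> 0"
    unfolding G_IV2_initial_iff by blast
  let ?B = "IV2_matrix (1 / a) (- b / (a * c)) (1 / c)
    (- d / (a * a * cnj a)) ((d * b / a - e) / (c * (a * cnj a)))"
  have B: "?B \<in> G_IV2_initial" unfolding G_IV2_initial_iff using *(2,3) by force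
  have "A ** ?B = mat 1" unfolding * by (rule IV2_matrix_right_inverse[OF *(2,3)])
  then have "?B ** A = mat 1" by (simp add: matrix_left_right_inverse)
  then have "inv\<^bsub>GL5\<^esub> A = ?B"
    using A B G_IV2_initial_invertible by (intro group.inv_equality[OF group_GL5]) (auto simp: GL5_def)
  then show "inv\<^bsub>GL5\<^esub> A \<in> G_IV2_initial" using B by simp
next
  fix A B assume "A \<in> G_IV2_initial" "B \<in> G_IV2_initial"
  then show "A \<otimes>\<^bsub>GL5\<^esub> B \<in> G_IV2_initial"
    unfolding G_IV2_initial_iff by (fastforce simp: GL5_def IV2_matrix_mult)
qed

text \<open>The equations of the group, apart from the entry \<open>(5, 5)\<close>, are real linear.\<close>

definition IV2_linear :: "(complex ^ 5 ^ 5) set" where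
  "IV2_linear = {A. A$1$2 = 0 \<and> A$1$3 = 0 \<and> A$1$4 = 0 \<and> A$1$5 = 0
     \<and> A$2$3 = 0 \<and> A$2$4 = 0 \<and> A$2$5 = 0
     \<and> A$3$1 = 0 \<and> A$3$2 = 0 \<and> A$3$3 = cnj (A$1$1) \<and> A$3$4 = 0 \<and> A$3$5 = 0
     \<and> A$4$1 = 0 \<and> A$4$2 = 0 \<and> A$4$3 = cnj (A$2$1) \<and> A$4$4 = cnj (A$2$2) \<and> A$4$5 = 0
     \<and> A$5$3 = cnj (A$5$1) \<and> A$5$4 = cnj (A$5$2)}"

lemma IV2_matrix_cases:
  "(A \<in> IV2_linear \<and> A$5$5 = A$2$2 * cnj (A$2$2))
    \<longleftrightarrow> A = IV2_matrix (A$2$2) (A$2$1) (A$1$1) (A$5$2) (A$5$1)"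
  by (auto simp: vec_eq_iff forall_5 IV2_linear_def)

lemma G_IV2_initial_equations:
  "A \<in> G_IV2_initial \<longleftrightarrow>
    A \<in> IV2_linear \<and> A$5$5 = A$2$2 * cnj (A$2$2) \<and> A$1$1 \<noteq> 0 \<and> A$2$2 \<noteq> 0"
proof
  assume "A \<in> G_IV2_initial"
  then show "A \<in> IV2_linear \<and> A$5$5 = A$2$2 * cnj (A$2$2) \<and> A$1$1 \<noteq> 0 \<and> A$2$2 \<noteq> 0"
    unfolding G_IV2_initial_iff IV2_linear_def by auto
next
  assume "A \<in> IV2_linear \<and> A$5$5 = A$2$2 * cnj (A$2$2) \<and> A$1$1 \<noteq> 0 \<and> A$2$2 \<noteq> 0"
  then show "A \<in> G_IV2_initial" using IV2_matrix_cases[of A] G_IV2_initial_iff by blast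
qed

section \<open>The group as a closed set and as a submanifold\<close>

text \<open>The equations cut out a closed set of matrices, and the open conditions that
  \<open>a\<close> and \<open>c\<close> be nonzero follow from invertibility.\<close>

lemma closedin_G_IV2_initial: "closedin (top_of_set (carrier GL5)) G_IV2_initial"
  unfolding closedin_closed
proof (intro exI conjI)
  let ?C = "IV2_linear \<inter> {A. A$5$5 = A$2$2 * cnj (A$2$2)}"
  show "closed ?C" unfolding IV2_linear_def
    by (intro closed_Int closed_Collect_conj closed_Collect_eq continuous_intros)
  show "G_IV2_initial = carrier GL5 \<inter> ?C"
  proof (intro equalityI subsetI)
    fix A assume "A \<in> G_IV2_initial"
    then show "A \<in> carrier GL5 \<inter> ?C"
      using G_IV2_initial_invertible unfolding G_IV2_initial_equations GL5_def by auto
  next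
    fix A assume A: "A \<in> carrier GL5 \<inter> ?C"
    then obtain B where "A ** B = mat 1" "B ** A = mat 1" unfolding GL5_def invertible_def by auto
    \<comment> \<open>Row 1 of \<open>A\<close> vanishes off the diagonal, which forces
      \<open>A$1$1\<close> to be nonzero; column 5 does too, which forces \<open>A$5$5\<close> and
      with it \<open>A$2$2\<close> to be nonzero.\<close>
    then have "(A ** B) $ 1 $ 1 = 1" "(B ** A) $ 5 $ 5 = 1" "(A ** B) $ 4 $ 4 = 1"
      "(B ** A) $ 2 $ 2 = 1" by (simp_all add: mat_def)
    then have "A$1$1 \<noteq> 0 \<and> A$2$2 \<noteq> 0"
      using A by (auto simp: matrix_matrix_mult_def sum_5 IV2_linear_def)
    then show "A \<in> G_IV2_initial" using A G_IV2_initial_equations by auto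
  qed
qed


text \<open>Five free complex entries give real dimension 10. The parametrization is only real
  linear because of the conjugated entries.\<close>

lemma dim_IV2_linear_slice: "dim (IV2_linear \<inter> {A. A$5$5 = 0}) = 10"
proof -
  define f :: "complex \<times> complex \<times> complex \<times> complex \<times> complex \<Rightarrow> complex ^ 5 ^ 5" where
    "f = (\<lambda>(a, b, c, d, e). vector [vector [c, 0, 0, 0, 0],
             vector [b, a, 0, 0, 0],
             vector [0, 0, cnj c, 0, 0],
             vector [0, 0, cnj b, cnj a, 0],
             vector [e, d, cnj e, cnj d, 0]])"
  have lin: "linear f"
    by (rule linearI) (auto simp: f_def vec_eq_iff forall_5 scaleR_conv_of_real[where 'a=complex])
  have inj: "inj f"
    by (rule injI) (auto simp: f_def vec_eq_iff forall_5)
  have "IV2_linear \<inter> {A. A$5$5 = 0} = range f"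
  proof (intro equalityI subsetI)
    fix A assume "A \<in> IV2_linear \<inter> {A. A$5$5 = 0}"
    then have "A = f (A$2$2, A$2$1, A$1$1, A$5$2, A$5$1)"
      unfolding f_def IV2_linear_def by (simp add: vec_eq_iff forall_5)
    then show "A \<in> range f" by blast
  qed (auto simp: f_def IV2_linear_def)
  moreover have "dim (range f) = dim (UNIV :: (complex \<times> complex \<times> complex \<times> complex \<times> complex) set)"
    using lin inj by (intro dim_image_eq) auto
  ultimately show ?thesis by simp
qed

text \<open>The chart is the shear that subtracts a times its conjugate from the entry (5, 5) and so
  straightens the group to a linear slice. It is undone by adding the same term back, because
  \<open>q\<close> depends only on \<open>A$2$2\<close>, which the shear fixes.\<close>

lemma embedded_submanifold_G_IV2_initial: "embedded_submanifold Cinf 10 G_IV2_initial"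
  unfolding embedded_submanifold_def
proof
  fix p assume p: "p \<in> G_IV2_initial"
  define h :: "complex \<Rightarrow> complex ^ 5 ^ 5" where "h z = axis 5 (axis 5 z)" for z
  have h_nth: "h z $ i $ j = (if i = 5 \<and> j = 5 then z else 0)" for z i j
    by (auto simp: h_def axis_def)
  define U :: "(complex ^ 5 ^ 5) set" where "U = {A. A$1$1 \<noteq> 0 \<and> A$2$2 \<noteq> 0}"
  define q where "q A = h (A$2$2 * cnj (A$2$2))" for A :: "complex ^ 5 ^ 5"
  have U: "open U"
    unfolding U_def by (intro open_Collect_conj open_Collect_neq continuous_intros)
  have "linear h" by (rule linearI) (auto simp: vec_eq_iff h_nth)
  then have h: "bounded_linear h" by (simp add: linear_conv_bounded_linear)
  have "linear (\<lambda>A::complex ^ 5 ^ 5. A$2$2)" by (rule linearI) auto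
  then have entry: "bounded_linear (\<lambda>A::complex ^ 5 ^ 5. A$2$2)" by (simp add: linear_conv_bounded_linear)
  have q: "Ck_on k U q" for k
    unfolding q_def
    by (intro Ck_on_linear[OF U h] Ck_on_bilinear[OF U bounded_bilinear_mult]
        Ck_on_linear[OF U bounded_linear_cnj] Ck_on_linear[OF U entry] Ck_on_ident[OF U])
  have "Ck_on k U (\<lambda>A. A - q A)" "Ck_on k U (\<lambda>A. A + q A)" for k
    using Ck_on_add[OF U Ck_on_ident[OF U] q]
      Ck_on_add[OF U Ck_on_ident[OF U] Ck_on_linear[OF U bounded_linear_minus[OF bounded_linear_ident] q]]
    by simp_all
  then have smooth: "of_class Cinf U (\<lambda>A. A - q A)" "of_class Cinf U (\<lambda>A. A + q A)" by simp_all
  have q_nth: "q A $ i $ j = (if i = 5 \<and> j = 5 then A$2$2 * cnj (A$2$2) else 0)" for A i j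
    by (simp add: q_def h_nth)
  have q_shift: "q (A - q A) = q A" "q (A + q A) = q A" for A
    by (simp_all add: q_def h_nth)
  have U_shift: "A - q A \<in> U \<longleftrightarrow> A \<in> U" "A + q A \<in> U \<longleftrightarrow> A \<in> U" for A
    by (simp_all add: U_def q_nth)
  let ?L = "IV2_linear \<inter> {A. A$5$5 = 0}"
  have G: "A \<in> G_IV2_initial \<longleftrightarrow> A \<in> U \<and> A - q A \<in> ?L" for A
    unfolding G_IV2_initial_equations by (auto simp: U_def IV2_linear_def q_nth)
  have image: "(\<lambda>A. A - q A) ` U = U"
  proof (intro equalityI subsetI)
    fix A assume "A \<in> U"
    then show "A \<in> (\<lambda>A. A - q A) ` U"
      using U_shift(2)[of A] q_shift(2)[of A] by (intro image_eqI[of _ _ "A + q A"]) auto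
  qed (auto simp: U_shift)
  have slice: "(\<lambda>A. A - q A) ` (G_IV2_initial \<inter> U) = U \<inter> ?L"
  proof (intro equalityI subsetI)
    fix A assume A: "A \<in> U \<inter> ?L"
    have "A + q A \<in> G_IV2_initial \<inter> U"
      using A U_shift(2)[of A] q_shift(2)[of A] by (simp add: G)
    then show "A \<in> (\<lambda>A. A - q A) ` (G_IV2_initial \<inter> U)"
      using q_shift(2)[of A] by (intro image_eqI[of _ _ "A + q A"]) auto
  qed (auto simp: G U_shift)
  have "subspace ?L"
    unfolding subspace_def by (auto simp: IV2_linear_def scaleR_conv_of_real[where 'a=complex])
  then show "\<exists>U W \<psi> \<phi> L. open U \<and> p \<in> U \<and> open W \<and> of_class Cinf U \<psi> \<and> of_class Cinf W \<phi> \<and>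
        \<psi> ` U = W \<and> (\<forall>x\<in>U. \<phi> (\<psi> x) = x) \<and>
        subspace (L :: (complex ^ 5 ^ 5) set) \<and> dim L = 10 \<and> \<psi> ` (G_IV2_initial \<inter> U) = W \<inter> L"
    using U p smooth image slice dim_IV2_linear_slice q_shift
    by (intro exI[of _ U] exI[of _ "\<lambda>A. A - q A"] exI[of _ "\<lambda>A. A + q A"] exI[of _ ?L])
      (auto simp: G simp del: of_class.simps)
qed

section \<open>Tangent vectors as limits of secants\<close>

text \<open>Membership of \<open>v\<close> in the tangent cone of \<open>S\<close> at
  \<open>p\<close>, with the sequences kept as witnesses.\<close>

definition secant_limit :: "'a::real_normed_vector set \<Rightarrow> 'a \<Rightarrow> 'a \<Rightarrow> (nat \<Rightarrow> 'a) \<Rightarrow> (nat \<Rightarrow> real) \<Rightarrow> bool" where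
  "secant_limit S p v x t \<longleftrightarrow>
     (\<forall>n. x n \<in> S \<and> t n > 0) \<and> t \<longlonglongrightarrow> 0 \<and> (\<lambda>n. (x n - p) /\<^sub>R t n) \<longlonglongrightarrow> v"

lemma secant_limit_tendsto:
  assumes "secant_limit S p v x t"
  shows "x \<longlonglongrightarrow> p"
proof -
  have "(\<lambda>n. t n *\<^sub>R ((x n - p) /\<^sub>R t n)) \<longlonglongrightarrow> 0 *\<^sub>R v"
    using assms unfolding secant_limit_def by (intro tendsto_scaleR) auto
  moreover have "t n *\<^sub>R ((x n - p) /\<^sub>R t n) = x n - p" for n
    using assms unfolding secant_limit_def by (simp add: less_imp_neq[symmetric])
  ultimately show ?thesis by (simp add: LIM_zero_iff)
qed

text \<open>The secant quotients converge, so \<open>x n - p\<close> is O(\<open>t n\<close>), and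
  the error of the linear approximation stays negligible after division by
  \<open>t n\<close>.\<close>

lemma has_derivative_secant_limit:
  assumes "secant_limit S p v x t" "(g has_derivative D) (at p within S)"
  shows "(\<lambda>n. (g (x n) - g p) /\<^sub>R t n) \<longlonglongrightarrow> D v"
proof -
  have x: "x n \<in> S" "t n > 0" for n using assms(1) unfolding secant_limit_def by auto
  have lim: "(\<lambda>n. (x n - p) /\<^sub>R t n) \<longlonglongrightarrow> v" using assms(1) unfolding secant_limit_def by auto
  interpret D: bounded_linear D using assms(2) by (rule has_derivative_bounded_linear)
  have "(\<lambda>n. (g (x n) - g p) /\<^sub>R t n - D ((x n - p) /\<^sub>R t n)) \<longlonglongrightarrow> 0"
  proof (rule LIMSEQ_I)
    fix e :: real assume e: "e > 0"
    \<comment> \<open>\<open>K\<close> eventually bounds the secant quotients; the tolerance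
      \<open>e / (2 * K)\<close> leaves an error of at most \<open>e / 2\<close>.\<close>
    define K where "K = norm v + 1"
    have K: "K > 0" by (simp add: K_def add_nonneg_pos)
    obtain d where d: "d > 0"
      "\<And>y. y \<in> S \<Longrightarrow> norm (y - p) < d \<Longrightarrow> norm (g y - g p - D (y - p)) \<le> e / (2 * K) * norm (y - p)"
      using assms(2) e K unfolding has_derivative_within_alt
      by (metis divide_pos_pos mult_pos_pos zero_less_numeral)
    have "\<forall>\<^sub>F n in sequentially. norm ((x n - p) /\<^sub>R t n) < K"
      using tendsto_norm[OF lim] by (rule order_tendstoD) (simp add: K_def)
    moreover have "\<forall>\<^sub>F n in sequentially. norm (x n - p) < d"
      using tendstoD[OF secant_limit_tendsto[OF assms(1)] d(1)] by (simp add: dist_norm)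
    ultimately have "\<forall>\<^sub>F n in sequentially.
      norm ((g (x n) - g p) /\<^sub>R t n - D ((x n - p) /\<^sub>R t n) - 0) < e"
    proof eventually_elim
      case (elim n)
      have "(g (x n) - g p) /\<^sub>R t n - D ((x n - p) /\<^sub>R t n) = (g (x n) - g p - D (x n - p)) /\<^sub>R t n"
        by (subst D.scaleR) (simp only: scaleR_diff_right)
      also have "norm \<dots> = norm (g (x n) - g p - D (x n - p)) / t n"
        unfolding norm_scaleR using x(2)[of n] by (simp add: field_simps)
      also have "\<dots> \<le> (e / (2 * K) * norm (x n - p)) / t n"
        using d(2)[OF x(1) elim(2)] x(2)[of n] by (intro divide_right_mono) auto
      also have "\<dots> = e / (2 * K) * norm ((x n - p) /\<^sub>R t n)"
        unfolding norm_scaleR using x(2)[of n] by (simp add: field_simps)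
      also have "\<dots> \<le> e / (2 * K) * K"
        using elim(1) e K by (intro mult_left_mono) auto
      also have "\<dots> < e" using e K by simp
      finally show ?case by simp
    qed
    then show "\<exists>no. \<forall>n\<ge>no. norm ((g (x n) - g p) /\<^sub>R t n - D ((x n - p) /\<^sub>R t n) - 0) < e"
      unfolding eventually_sequentially .
  qed
  moreover have "(\<lambda>n. D ((x n - p) /\<^sub>R t n)) \<longlonglongrightarrow> D v" by (rule D.tendsto[OF lim])
  ultimately show ?thesis using tendsto_add by fastforce
qed

text \<open>A derivative within a hypersurface is not unique as a linear map; its values on tangent
  vectors are, being limits of difference quotients.\<close>

lemma has_derivative_secant_unique:
  assumes "secant_limit S p v x t"
    "(g has_derivative D) (at p within S)" "(g has_derivative D') (at p within S)"
  shows "D v = D' v"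
  using has_derivative_secant_limit[OF assms(1,2)] has_derivative_secant_limit[OF assms(1,3)]
  by (rule LIMSEQ_unique)

text \<open>For small \<open>t\<close> the function has opposite signs at
  \<open>p + t *\<^sub>R (v + e *\<^sub>R w')\<close> and
  \<open>p + t *\<^sub>R (v - e *\<^sub>R w')\<close>, so it vanishes at some point between them.
  Letting \<open>e\<close> tend to 0 gives points of the level set whose secants tend to
  \<open>v\<close>.\<close>

lemma level_set_secant_limit:
  fixes f :: "'a::euclidean_space \<Rightarrow> real"
  assumes "open U" "p \<in> U" "continuous_on U f" "(f has_derivative D) (at p)" "f p = 0"
    "D v = 0" "D w \<noteq> 0"
  shows "\<exists>x t. secant_limit {x \<in> U. f x = 0} p v x t"
proof -
  define w' where "w' = (if D w > 0 then w else - w)"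
  interpret D: bounded_linear D using assms(4) by (rule has_derivative_bounded_linear)
  have w': "D w' > 0" using assms(7) by (auto simp: w'_def linear_neg[OF D.linear_axioms])
  have deriv: "((\<lambda>t. f (p + t *\<^sub>R (v + s *\<^sub>R w'))) has_real_derivative s * D w') (at 0)" for s
  proof -
    have "((\<lambda>t. f (p + t *\<^sub>R (v + s *\<^sub>R w'))) has_derivative (\<lambda>t. D (t *\<^sub>R (v + s *\<^sub>R w')))) (at 0)"
      by (rule has_derivative_compose[where g=f and f="\<lambda>t. p + t *\<^sub>R (v + s *\<^sub>R w')"])
        (use assms(4) in \<open>auto intro!: derivative_eq_intros\<close>)
    then show ?thesis
      unfolding has_field_derivative_def
      by (rule has_derivative_eq_rhs) (simp add: fun_eq_iff D.scaleR D.add assms(6))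
  qed
  have ex: "\<exists>t s. 0 < t \<and> t < e \<and> \<bar>s\<bar> \<le> e \<and> p + t *\<^sub>R (v + s *\<^sub>R w') \<in> U \<and> f (p + t *\<^sub>R (v + s *\<^sub>R w')) = 0"
    if e: "e > 0" for e :: real
  proof -
    obtain r where r: "r > 0" "ball p r \<subseteq> U" using assms(1,2) open_contains_ball by blast
    obtain d1 where d1: "d1 > 0" "\<And>h. 0 < h \<Longrightarrow> h < d1 \<Longrightarrow> f (p + h *\<^sub>R (v + e *\<^sub>R w')) > 0"
      using DERIV_pos_inc_right[OF deriv[of e]] e w' assms(5) by auto
    obtain d2 where d2: "d2 > 0" "\<And>h. 0 < h \<Longrightarrow> h < d2 \<Longrightarrow> f (p + h *\<^sub>R (v + (- e) *\<^sub>R w')) < 0"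
      using DERIV_neg_dec_right[OF deriv[of "- e"]] e w' assms(5) by (auto simp: mult_pos_pos)
    \<comment> \<open>\<open>N\<close> bounds the norm of \<open>v + s *\<^sub>R w'\<close> for
      \<open>\<bar>s\<bar> \<le> e\<close>, so steps shorter than \<open>r / N\<close> stay in the
      ball. Halving \<open>m\<close> makes all bounds strict.\<close>
    define N where "N = norm v + e * norm w' + 1"
    have N: "N > 0" using e by (simp add: N_def add_nonneg_pos)
    define m where "m = min (min d1 d2) (min e (r / N))"
    have m: "m > 0" "m \<le> d1" "m \<le> d2" "m \<le> e" "m \<le> r / N"
      using d1(1) d2(1) e r N by (simp_all add: m_def min_le_iff_disj)
    define t where "t = m / 2"
    have t: "0 < t" "t < d1" "t < d2" "t < e" "t < r / N"
      using m unfolding t_def by linarith+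
    have in_U: "p + t *\<^sub>R (v + s *\<^sub>R w') \<in> U" if "\<bar>s\<bar> \<le> e" for s
    proof -
      have "norm (v + s *\<^sub>R w') \<le> norm v + \<bar>s\<bar> * norm w'"
        using norm_triangle_ineq[of v "s *\<^sub>R w'"] by simp
      also have "\<dots> \<le> N" using mult_right_mono[OF that, of "norm w'"] by (simp add: N_def)
      finally have "t * norm (v + s *\<^sub>R w') \<le> t * N" using t by (simp add: mult_left_mono)
      also have "\<dots> < r" using t(5) N by (simp add: less_divide_eq)
      finally have "p + t *\<^sub>R (v + s *\<^sub>R w') \<in> ball p r" using t(1) by (simp add: dist_norm)
      then show ?thesis using r(2) by blast
    qed
    have "continuous_on {- e..e} (\<lambda>s. f (p + t *\<^sub>R (v + s *\<^sub>R w')))"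
      by (rule continuous_on_compose2[OF assms(3)]) (auto intro!: continuous_intros in_U)
    then have "\<exists>s\<ge>- e. s \<le> e \<and> f (p + t *\<^sub>R (v + s *\<^sub>R w')) = 0"
      using d1(2)[OF t(1,2)] d2(2)[OF t(1,3)] e by (intro IVT') auto
    then obtain s where s: "\<bar>s\<bar> \<le> e" "f (p + t *\<^sub>R (v + s *\<^sub>R w')) = 0"
      by (metis abs_le_iff minus_le_iff)
    show ?thesis using t(1,4) s in_U[OF s(1)] by blast
  qed
  have "\<forall>n. \<exists>t s. 0 < t \<and> t < inverse (real (Suc n)) \<and> \<bar>s\<bar> \<le> inverse (real (Suc n))
      \<and> p + t *\<^sub>R (v + s *\<^sub>R w') \<in> U \<and> f (p + t *\<^sub>R (v + s *\<^sub>R w')) = 0"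
    by (intro allI ex) simp
  then obtain t s where ts: "\<And>n. 0 < t n" "\<And>n. t n < inverse (real (Suc n))"
    "\<And>n. \<bar>s n\<bar> \<le> inverse (real (Suc n))"
    "\<And>n. p + t n *\<^sub>R (v + s n *\<^sub>R w') \<in> U" "\<And>n. f (p + t n *\<^sub>R (v + s n *\<^sub>R w')) = 0" by metis
  have t0: "t \<longlonglongrightarrow> 0"
    by (rule tendsto_sandwich[OF _ _ tendsto_const LIMSEQ_inverse_real_of_nat])
      (use ts(1,2) in \<open>auto intro!: always_eventually less_imp_le\<close>)
  have s0: "s \<longlonglongrightarrow> 0"
    by (rule Lim_null_comparison[OF _ LIMSEQ_inverse_real_of_nat]) (use ts(3) in auto)
  have "(\<lambda>n. v + s n *\<^sub>R w') \<longlonglongrightarrow> v + 0 *\<^sub>R w'" by (intro tendsto_intros s0)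
  moreover have "((p + t n *\<^sub>R (v + s n *\<^sub>R w')) - p) /\<^sub>R t n = v + s n *\<^sub>R w'" for n
    using ts(1)[of n] by simp
  ultimately have "secant_limit {x \<in> U. f x = 0} p v (\<lambda>n. p + t n *\<^sub>R (v + s n *\<^sub>R w')) t"
    unfolding secant_limit_def using ts t0 by simp
  then show ?thesis by blast
qed

lemma tangent_space_secant_limit:
  assumes "v \<in> tangent_space M p" "p \<in> M"
  shows "\<exists>x t. secant_limit M p v x t"
proof -
  obtain U \<rho> where U: "p \<in> U" "local_defining_function (Ck 1) M U \<rho>" "frechet_derivative \<rho> (at p) v = 0"
    using assms(1) unfolding tangent_space_def by blast
  then have c: "open U" "Ck_on (Suc 0) U \<rho>" "M \<inter> U = {x \<in> U. \<rho> x = 0}"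
    "\<exists>w. frechet_derivative \<rho> (at p) w \<noteq> 0"
    unfolding local_defining_function_def by auto
  have "\<rho> p = 0" using assms(2) U(1) c(3) by blast
  obtain w where "frechet_derivative \<rho> (at p) w \<noteq> 0" using c(4) by blast
  then obtain x t where "secant_limit {x \<in> U. \<rho> x = 0} p v x t"
    using level_set_secant_limit[OF c(1) U(1) _ Ck_on_SucD(1)[OF c(2) U(1)] \<open>\<rho> p = 0\<close> U(3)]
      Ck_on_Suc_imp[OF c(2)] by (metis Ck_on.simps(1))
  then have "secant_limit M p v x t" using c(3) unfolding secant_limit_def by blast
  then show ?thesis by blast
qed

text \<open>The definition of \<open>tangent_space\<close> admits every defining function. Secants
  of \<open>M\<close> produced by one of them annihilate the difference quotients of any other, so
  all kernels coincide.\<close>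

lemma tangent_space_eq_kernel:
  assumes "local_defining_function (Ck 1) M U \<rho>" "p \<in> M" "p \<in> U"
  shows "tangent_space M p = {v. frechet_derivative \<rho> (at p) v = 0}"
proof (intro equalityI subsetI)
  fix v assume v: "v \<in> tangent_space M p"
  have c: "open U" "Ck_on (Suc 0) U \<rho>" "M \<inter> U = {x \<in> U. \<rho> x = 0}"
    using assms(1) unfolding local_defining_function_def by auto
  obtain x t where xt: "secant_limit M p v x t" using tangent_space_secant_limit[OF v assms(2)] by blast
  have "(\<lambda>n. (\<rho> (x n) - \<rho> p) /\<^sub>R t n) \<longlonglongrightarrow> frechet_derivative \<rho> (at p) v"
    by (rule has_derivative_secant_limit[OF xt has_derivative_at_withinI[OF Ck_on_SucD(1)[OF c(2) assms(3)]]])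
  moreover have "\<forall>\<^sub>F n in sequentially. x n \<in> U"
    using topological_tendstoD[OF secant_limit_tendsto[OF xt] c(1) assms(3)] .
  then have "\<forall>\<^sub>F n in sequentially. (\<rho> (x n) - \<rho> p) /\<^sub>R t n = 0"
  proof eventually_elim
    case (elim n)
    have "x n \<in> M" using xt unfolding secant_limit_def by blast
    then have "\<rho> (x n) = 0" "\<rho> p = 0" using elim c(3) assms(2,3) by blast+
    then show ?case by simp
  qed
  then have "(\<lambda>n. (\<rho> (x n) - \<rho> p) /\<^sub>R t n) \<longlonglongrightarrow> 0" by (rule tendsto_eventually)
  ultimately have "frechet_derivative \<rho> (at p) v = 0" by (rule LIMSEQ_unique)
  then show "v \<in> {v. frechet_derivative \<rho> (at p) v = 0}" by simp
qed (use assms in \<open>auto simp: tangent_space_def\<close>)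

section \<open>Complexified vectors\<close>

lemma cscale_simps [simp]:
  "fst (cscale c Z) = Re c *\<^sub>R fst Z - Im c *\<^sub>R snd Z"
  "snd (cscale c Z) = Re c *\<^sub>R snd Z + Im c *\<^sub>R fst Z"
  by (simp_all add: cscale_def)

lemma cconj_simps [simp]: "fst (cconj Z) = fst Z" "snd (cconj Z) = - snd Z"
  by (simp_all add: cconj_def)

lemma cconj_cconj [simp]: "cconj (cconj Z) = Z"
  by (simp add: prod_eq_iff)

lemma cconj_add: "cconj (Z + W) = cconj Z + cconj W"
  and cconj_diff: "cconj (Z - W) = cconj Z - cconj W"
  and cconj_cscale: "cconj (cscale c Z) = cscale (cnj c) (cconj Z)"
  by (simp_all add: prod_eq_iff algebra_simps)

lemma JC_simps [simp]: "fst (JC Z) = \<i> *s fst Z" "snd (JC Z) = \<i> *s snd Z"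
  by (simp_all add: JC_def)

lemma vector_scaleR_commute_C3: "c *s (r *\<^sub>R v) = r *\<^sub>R (c *s (v :: C3))"
  by (simp add: vec_eq_iff)

lemma JC_add: "JC (Z + W) = JC Z + JC W"
  and JC_diff: "JC (Z - W) = JC Z - JC W"
  and JC_cscale: "JC (cscale c Z) = cscale c (JC Z)"
  and JC_cconj: "JC (cconj Z) = cconj (JC Z)"
  and JC_JC: "JC (JC Z) = - Z"
  by (simp_all add: prod_eq_iff vec_eq_iff algebra_simps)

lemma bounded_linear_JC: "bounded_linear JC"
proof -
  have "linear JC"
    by (rule linearI) (simp_all add: JC_add prod_eq_iff vector_scaleR_commute_C3)
  then show ?thesis by (simp add: linear_conv_bounded_linear)
qed

lemma bounded_linear_cconj: "bounded_linear (cconj :: C3 \<times> C3 \<Rightarrow> C3 \<times> C3)"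
proof -
  have "linear (cconj :: C3 \<times> C3 \<Rightarrow> C3 \<times> C3)" by (rule linearI) (simp_all add: prod_eq_iff)
  then show ?thesis by (simp add: linear_conv_bounded_linear)
qed

lemma bounded_linear_cscale: "bounded_linear (cscale c :: C3 \<times> C3 \<Rightarrow> C3 \<times> C3)"
proof -
  have "linear (cscale c :: C3 \<times> C3 \<Rightarrow> C3 \<times> C3)"
    by (rule linearI) (simp_all add: prod_eq_iff algebra_simps)
  then show ?thesis by (simp add: linear_conv_bounded_linear)
qed

lemma has_derivative_transform_within_nbhd:
  assumes "(f has_derivative f') (at q within S)" "q \<in> S" "open W" "q \<in> W"
    "\<And>x. x \<in> S \<Longrightarrow> x \<in> W \<Longrightarrow> f x = g x"
  shows "(g has_derivative f') (at q within S)"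
proof -
  obtain e where e: "e > 0" "ball q e \<subseteq> W" using assms(3,4) open_contains_ball by blast
  show ?thesis
  proof (rule has_derivative_transform_within[OF assms(1) e(1) assms(2)])
    fix x assume "x \<in> S" "dist x q < e"
    then show "f x = g x" using e(2) by (intro assms(5)) (auto simp: dist_commute)
  qed
qed

lemma of_class_on_subset_mono:
  assumes "of_class_on_subset r V f" "V' \<subseteq> V"
  shows "of_class_on_subset r V' f"
  unfolding of_class_on_subset_def
proof
  fix p assume "p \<in> V'"
  then have "p \<in> V" using assms(2) by blast
  from bspec[OF assms(1)[unfolded of_class_on_subset_def] this] obtain U g where
    "open U" "p \<in> U" "of_class r U g" "\<forall>x\<in>V \<inter> U. f x = g x" by (elim exE conjE)
  then show "\<exists>U g. open U \<and> p \<in> U \<and> of_class r U g \<and> (\<forall>x\<in>V' \<inter> U. f x = g x)"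
    using assms(2) by (intro exI[of _ U] exI[of _ g]) auto
qed

lemma local_section_mono: "local_section r V B X \<Longrightarrow> V' \<subseteq> V \<Longrightarrow> local_section r V' B X"
  unfolding local_section_def using of_class_on_subset_mono by blast

section \<open>The Levi form at a point\<close>

text \<open>Class C^2 provides the Hessian of \<rho> at \<open>q\<close> and its symmetry.\<close>

locale hypersurface_point =
  fixes M U :: "C3 set" and \<rho> :: "C3 \<Rightarrow> real" and q :: C3
  assumes defining: "local_defining_function (Ck 2) M U \<rho>" and q_in_M: "q \<in> M" and q_in_U: "q \<in> U"
begin

definition D :: "C3 \<Rightarrow> C3 \<Rightarrow> real" where
  "D x v = frechet_derivative \<rho> (at x) v"

definition H :: "C3 \<Rightarrow> C3 \<Rightarrow> real" where
  "H a b = frechet_derivative (\<lambda>x. D x b) (at q) a"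

lemma open_U: "open U" and C2: "Ck_on 2 U \<rho>"
  using defining unfolding local_defining_function_def by auto

lemma defining_C1: "local_defining_function (Ck 1) M U \<rho>"
  using defining Ck_on_mono[OF C2, of 1] unfolding local_defining_function_def by auto

lemma linear_D: "x \<in> U \<Longrightarrow> linear (D x)"
  using Ck_on_SucD(1)[of 1 U \<rho> x] C2 has_derivative_linear unfolding D_def[abs_def]
  by (metis Suc_1)

lemma has_derivative_D: "((\<lambda>x. D x b) has_derivative (\<lambda>a. H a b)) (at q)"
proof -
  have "Ck_on (Suc 0) U (\<lambda>x. D x b)"
    using Ck_on_SucD(2)[of 1 U \<rho> b] C2 unfolding D_def by (metis One_nat_def Suc_1)
  then show ?thesis using Ck_on_SucD(1) q_in_U unfolding H_def by blast
qed

lemma H_commute: "H a b = H b a"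
  using Ck2_second_derivative_symmetric[OF open_U C2 q_in_U] unfolding H_def D_def by metis

lemma linear_H_left: "linear (\<lambda>a. H a b)"
  using has_derivative_D has_derivative_linear by blast

lemma linear_H_right: "linear (H a)"
  using linear_H_left[of a] H_commute by (metis (no_types, lifting) ext)

lemma tangent_space_iff: "x \<in> M \<Longrightarrow> x \<in> U \<Longrightarrow> v \<in> tangent_space M x \<longleftrightarrow> D x v = 0"
  using tangent_space_eq_kernel[OF defining_C1] unfolding D_def by blast

section \<open>Differentiating the tangency condition along the hypersurface\<close>

text \<open>Product rule for a linear form applied to a vector, both depending on the point, through
  coordinates.\<close>

lemma has_derivative_D_field:
  assumes "(Y has_derivative Y') (at q within S)" "q \<in> S"
  shows "((\<lambda>x. D x (Y x)) has_derivative (\<lambda>a. H a (Y q) + D q (Y' a))) (at q within S)"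
proof (rule has_derivative_transform_within_nbhd[OF _ assms(2) open_U q_in_U])
  have "((\<lambda>x. \<Sum>j\<in>Basis. (Y x \<bullet> j) * D x j) has_derivative
      (\<lambda>a. \<Sum>j\<in>Basis. (Y q \<bullet> j) * H a j + (Y' a \<bullet> j) * D q j)) (at q within S)"
    by (intro has_derivative_sum has_derivative_mult has_derivative_inner_left[OF assms(1)]
        has_derivative_at_withinI[OF has_derivative_D])
  moreover have "(\<Sum>j\<in>Basis. (Y q \<bullet> j) * H a j + (Y' a \<bullet> j) * D q j) = H a (Y q) + D q (Y' a)" for a
    using linear_eq_sum_Basis[OF linear_H_right, of a "Y q"] linear_eq_sum_Basis[OF linear_D[OF q_in_U], of "Y' a"]
    by (simp add: sum.distrib)
  ultimately show "((\<lambda>x. \<Sum>j\<in>Basis. (Y x \<bullet> j) * D x j) has_derivative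
      (\<lambda>a. H a (Y q) + D q (Y' a))) (at q within S)" by simp
  show "(\<Sum>j\<in>Basis. (Y x \<bullet> j) * D x j) = D x (Y x)" if "x \<in> U" for x
    using linear_eq_sum_Basis[OF linear_D[OF that], of "Y x"] by simp
qed

lemma derivative_within_unique:
  assumes "v \<in> tangent_space M q"
    "(g has_derivative E) (at q within M)" "(g has_derivative E') (at q within M)"
  shows "E v = E' v"
  using tangent_space_secant_limit[OF assms(1) q_in_M] has_derivative_secant_unique assms(2,3) by metis

text \<open>The function \<open>\<lambda>x. D x (Y x)\<close> is zero on \<open>M\<close> near
  \<open>q\<close>, so its derivative vanishes on tangent vectors.\<close>

lemma D_derivative_tangent_field:
  assumes "(Y has_derivative Y') (at q within M)" "open W" "q \<in> W"
    and "\<And>x. x \<in> M \<Longrightarrow> x \<in> U \<Longrightarrow> x \<in> W \<Longrightarrow> Y x \<in> tangent_space M x"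
    and "a \<in> tangent_space M q"
  shows "D q (Y' a) = - H a (Y q)"
proof -
  have "((\<lambda>x. 0) has_derivative (\<lambda>a. H a (Y q) + D q (Y' a))) (at q within M)"
    by (rule has_derivative_transform_within_nbhd[OF has_derivative_D_field[OF assms(1) q_in_M] q_in_M
          open_Int[OF assms(2) open_U]]) (use assms(3,4) q_in_U tangent_space_iff in auto)
  then have "H a (Y q) + D q (Y' a) = 0"
    using derivative_within_unique[OF assms(5) _ has_derivative_const] by fastforce
  then show ?thesis by simp
qed

text \<open>The \<open>\<complex>\<close>-linear extension of \<open>d\<rho>\<close> at \<open>q\<close> and the \<open>\<complex>\<close>-bilinear extension of the Hessian.\<close>

definition DC :: "C3 \<times> C3 \<Rightarrow> complex" where
  "DC Z = Complex (D q (fst Z)) (D q (snd Z))"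

definition HC :: "C3 \<times> C3 \<Rightarrow> C3 \<times> C3 \<Rightarrow> complex" where
  "HC Z W = Complex (H (fst Z) (fst W) - H (snd Z) (snd W)) (H (fst Z) (snd W) + H (snd Z) (fst W))"

lemmas D_linear_simps = linear_add[OF linear_D[OF q_in_U]] linear_diff[OF linear_D[OF q_in_U]]
  linear_cmul[OF linear_D[OF q_in_U]] linear_neg[OF linear_D[OF q_in_U]] linear_0[OF linear_D[OF q_in_U]]

lemmas H_linear_simps = linear_add[OF linear_H_left] linear_diff[OF linear_H_left]
  linear_cmul[OF linear_H_left] linear_neg[OF linear_H_left]
  linear_add[OF linear_H_right] linear_diff[OF linear_H_right]
  linear_cmul[OF linear_H_right] linear_neg[OF linear_H_right]

lemma DC_add: "DC (Z + W) = DC Z + DC W"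
  and DC_diff: "DC (Z - W) = DC Z - DC W"
  and DC_cscale: "DC (cscale c Z) = c * DC Z"
  and DC_cconj: "DC (cconj Z) = cnj (DC Z)"
  by (simp_all add: DC_def complex_eq_iff D_linear_simps)

lemma HC_commute: "HC Z W = HC W Z"
  by (simp add: HC_def complex_eq_iff H_commute)

lemma HC_cconj: "HC (cconj Z) (cconj W) = cnj (HC Z W)"
  by (simp add: HC_def complex_eq_iff H_linear_simps)

lemma HC_add_right: "HC Z (W + W') = HC Z W + HC Z W'"
  and HC_cscale_right: "HC Z (cscale c W) = c * HC Z W"
  by (simp_all add: HC_def complex_eq_iff H_linear_simps algebra_simps)

lemma HC_add_left: "HC (Z + Z') W = HC Z W + HC Z' W"
  and HC_cscale_left: "HC (cscale c Z) W = c * HC Z W"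
  by (simp_all add: HC_def complex_eq_iff H_linear_simps algebra_simps)

lemma CTM_iff: "Z \<in> CTM M q \<longleftrightarrow> DC Z = 0"
  by (cases Z) (simp add: CTM_def DC_def complex_eq_iff tangent_space_iff[OF q_in_M q_in_U])

text \<open>Removes the arbitrary choice made by \<open>frechet_derivative\<close> within
  \<open>M\<close>: any derivative gives the same value on tangent vectors.\<close>

lemma deriv_along_eq:
  assumes "(Y has_derivative Y') (at q within M)" "Z \<in> CTM M q"
  shows "deriv_along M q Z Y = Y' (fst Z) + cscale \<i> (Y' (snd Z))"
proof -
  have "(Y has_derivative frechet_derivative Y (at q within M)) (at q within M)"
    using assms(1) frechet_derivative_works differentiable_def by blast
  then have "frechet_derivative Y (at q within M) v = Y' v" if "v \<in> tangent_space M q" for v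
    using derivative_within_unique[OF that] assms(1) by blast
  then show ?thesis using assms(2) by (auto simp: deriv_along_def CTM_def Let_def)
qed

lemma DC_deriv_along:
  assumes "(Y has_derivative Y') (at q within M)" "open W" "q \<in> W"
    and "\<And>x. x \<in> M \<Longrightarrow> x \<in> U \<Longrightarrow> x \<in> W \<Longrightarrow> Y x \<in> CTM M x"
    and "Z \<in> CTM M q"
  shows "DC (deriv_along M q Z Y) = - HC Z (Y q)"
proof -
  have "D q (fst (Y' a)) = - H a (fst (Y q))" if "a \<in> tangent_space M q" for a
    by (rule D_derivative_tangent_field[OF has_derivative_fst[OF assms(1)] assms(2,3) _ that])
      (use assms(4) in \<open>auto simp: CTM_def mem_Times_iff\<close>)
  moreover have "D q (snd (Y' a)) = - H a (snd (Y q))" if "a \<in> tangent_space M q" for a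
    by (rule D_derivative_tangent_field[OF has_derivative_snd[OF assms(1)] assms(2,3) _ that])
      (use assms(4) in \<open>auto simp: CTM_def mem_Times_iff\<close>)
  ultimately show ?thesis
    using assms(5) unfolding deriv_along_eq[OF assms(1,5)]
    by (auto simp: DC_def HC_def complex_eq_iff D_linear_simps CTM_def)
qed

text \<open>\<open>JC\<close> is a constant linear map, so it commutes with differentiation and the
  preceding formula applies to \<open>JC \<circ> Y\<close>.\<close>

lemma DC_JC_deriv_along:
  assumes "(Y has_derivative Y') (at q within M)" "open W" "q \<in> W"
    and "\<And>x. x \<in> M \<Longrightarrow> x \<in> U \<Longrightarrow> x \<in> W \<Longrightarrow> JC (Y x) \<in> CTM M x"
    and "Z \<in> CTM M q"
  shows "DC (JC (deriv_along M q Z Y)) = - HC Z (JC (Y q))"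
proof -
  have d: "((\<lambda>x. JC (Y x)) has_derivative (\<lambda>a. JC (Y' a))) (at q within M)"
    by (rule bounded_linear.has_derivative[OF bounded_linear_JC assms(1)])
  have "deriv_along M q Z (\<lambda>x. JC (Y x)) = JC (deriv_along M q Z Y)"
    unfolding deriv_along_eq[OF assms(1,5)] deriv_along_eq[OF d assms(5)] by (simp add: JC_add JC_cscale)
  then show ?thesis using DC_deriv_along[OF d assms(2-5)] by simp
qed

lemma deriv_along_cconj:
  assumes "(Y has_derivative Y') (at q within M)" "Z \<in> CTM M q"
  shows "deriv_along M q Z (cconj \<circ> Y) = cconj (deriv_along M q (cconj Z) Y)"
proof -
  have d: "((cconj \<circ> Y) has_derivative (\<lambda>a. cconj (Y' a))) (at q within M)"
    unfolding o_def by (rule bounded_linear.has_derivative[OF bounded_linear_cconj assms(1)])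
  have lin: "linear Y'" by (rule has_derivative_linear[OF assms(1)])
  have "cconj Z \<in> CTM M q" using assms(2) by (simp add: CTM_iff DC_cconj)
  then show ?thesis
    unfolding deriv_along_eq[OF assms(1)] deriv_along_eq[OF d assms(2)]
    by (simp add: deriv_along_eq[OF assms(1)] prod_eq_iff linear_neg[OF lin])
qed

section \<open>Brackets of (1,0) fields\<close>

definition field10 :: "cfield \<Rightarrow> bool" where
  "field10 X \<longleftrightarrow> (\<exists>X'. (X has_derivative X') (at q within M)) \<and>
     (\<exists>W. open W \<and> q \<in> W \<and> (\<forall>x\<in>M \<inter> W. X x \<in> T10 M x))"

lemma field10_at: "field10 X \<Longrightarrow> X q \<in> T10 M q"
  using q_in_M unfolding field10_def by blast

lemma T10_CTM: "Z \<in> T10 M x \<Longrightarrow> Z \<in> CTM M x"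
  by (simp add: T10_def)

lemma CTM_closed:
  assumes "x \<in> M" "x \<in> U" "Z \<in> CTM M x"
  shows "cscale c Z \<in> CTM M x" "cconj Z \<in> CTM M x"
  using assms(3) linear_D[OF assms(2)]
  by (auto simp: CTM_def tangent_space_iff[OF assms(1,2)] cscale_def cconj_def
      linear_add linear_diff linear_cmul linear_neg)

text \<open>In \<open>DC\<close> of the bracket the two Hessian terms cancel by symmetry. After
  \<open>JC\<close>, which acts as i on \<open>X\<close> and as -i on the conjugate of
  \<open>Y\<close>, they add up instead.\<close>

lemma bracket_cconj_T10:
  assumes "field10 X" "field10 Y"
  shows "bracket M X (cconj \<circ> Y) q \<in> CTM M q"
    and "DC (JC (bracket M X (cconj \<circ> Y) q)) = 2 * \<i> * HC (X q) (cconj (Y q))"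
proof -
  obtain X' V where X: "(X has_derivative X') (at q within M)" "open V" "q \<in> V"
    "\<And>x. x \<in> M \<Longrightarrow> x \<in> V \<Longrightarrow> X x \<in> T10 M x" using assms(1) unfolding field10_def by blast
  obtain Y' W where Y: "(Y has_derivative Y') (at q within M)" "open W" "q \<in> W"
    "\<And>x. x \<in> M \<Longrightarrow> x \<in> W \<Longrightarrow> Y x \<in> T10 M x" using assms(2) unfolding field10_def by blast
  have d: "((cconj \<circ> Y) has_derivative (\<lambda>a. cconj (Y' a))) (at q within M)"
    unfolding o_def by (rule bounded_linear.has_derivative[OF bounded_linear_cconj Y(1)])
  have J: "JC Z = cscale \<i> Z" if "Z \<in> T10 M x" for Z x using that by (simp add: T10_def)
  have Jc: "JC (cconj Z) = cscale (- \<i>) (cconj Z)" if "Z \<in> T10 M x" for Z x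
    using J[OF that] by (simp add: JC_cconj cconj_cscale)
  have C: "cconj Z \<in> CTM M x" "JC Z \<in> CTM M x" "JC (cconj Z) \<in> CTM M x"
    if "x \<in> M" "x \<in> U" "Z \<in> T10 M x" for Z x
    using CTM_closed[OF that(1,2)] T10_CTM[OF that(3)] J[OF that(3)] Jc[OF that(3)]
    by (simp_all del: cplx.scale_minus_left)
  have Xq: "X q \<in> CTM M q" and Yq: "cconj (Y q) \<in> CTM M q"
    using field10_at[OF assms(1)] field10_at[OF assms(2)] q_in_M q_in_U CTM_closed T10_CTM by auto
  have "DC (deriv_along M q (X q) (cconj \<circ> Y)) = - HC (X q) ((cconj \<circ> Y) q)"
    by (rule DC_deriv_along[OF d Y(2,3) _ Xq]) (use Y(4) C in auto)
  moreover have "DC (deriv_along M q (cconj (Y q)) X) = - HC (cconj (Y q)) (X q)"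
    by (rule DC_deriv_along[OF X(1-3) _ Yq]) (use X(4) T10_CTM in auto)
  ultimately show "bracket M X (cconj \<circ> Y) q \<in> CTM M q"
    by (simp add: CTM_iff bracket_def DC_diff HC_commute)
  have "DC (JC (deriv_along M q (X q) (cconj \<circ> Y))) = - HC (X q) (JC ((cconj \<circ> Y) q))"
    by (rule DC_JC_deriv_along[OF d Y(2,3) _ Xq]) (use Y(4) C in auto)
  moreover have "DC (JC (deriv_along M q (cconj (Y q)) X)) = - HC (cconj (Y q)) (JC (X q))"
    by (rule DC_JC_deriv_along[OF X(1-3) _ Yq]) (use X(4) C in auto)
  ultimately show "DC (JC (bracket M X (cconj \<circ> Y) q)) = 2 * \<i> * HC (X q) (cconj (Y q))"
    using J[OF field10_at[OF assms(1)]] Jc[OF field10_at[OF assms(2)]]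
    by (simp add: bracket_def JC_diff DC_diff HC_cscale_right HC_commute[of "cconj (Y q)"]
        del: cplx.scale_minus_left)
qed

text \<open>The bracket has the form \<open>cconj W - W\<close>, which is purely imaginary, so
  multiplication by i makes it real.\<close>

lemma cconj_bracket_self:
  assumes "field10 X"
  shows "cconj (cscale \<i> (bracket M X (cconj \<circ> X) q)) = cscale \<i> (bracket M X (cconj \<circ> X) q)"
proof -
  obtain X' where X: "(X has_derivative X') (at q within M)" using assms unfolding field10_def by blast
  have "X q \<in> CTM M q" using field10_at[OF assms] T10_CTM by blast
  then have "bracket M X (cconj \<circ> X) q
    = cconj (deriv_along M q (cconj (X q)) X) - deriv_along M q (cconj (X q)) X"
    by (simp add: bracket_def deriv_along_cconj[OF X])
  then show ?thesis by (simp add: prod_eq_iff)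
qed

lemma zero_T10: "0 \<in> T10 M q"
  by (simp add: T10_def CTM_iff DC_def D_linear_simps complex_eq_iff prod_eq_iff zero_prod_def)

lemma T10_add: "Z \<in> T10 M q \<Longrightarrow> W \<in> T10 M q \<Longrightarrow> Z + W \<in> T10 M q"
  by (simp add: T10_def CTM_iff DC_add JC_add cplx.scale_right_distrib)

lemma T10_cscale: "Z \<in> T10 M q \<Longrightarrow> cscale c Z \<in> T10 M q"
  by (simp add: T10_def CTM_iff DC_cscale JC_cscale mult.commute)

lemma T01_iff: "Z \<in> T01 M q \<longleftrightarrow> cconj Z \<in> T10 M q"
  unfolding T01_def by (metis cconj_cconj image_iff)

text \<open>The condition says that \<open>JC Z\<close> is tangent as well, and then so are the
  projections of \<open>Z\<close> to the two eigenspaces of \<open>JC\<close>.\<close>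

lemma T10_T01_iff:
  assumes "Z \<in> CTM M q"
  shows "Z \<in> T10 M q + T01 M q \<longleftrightarrow> DC (JC Z) = 0"
proof
  assume "Z \<in> T10 M q + T01 M q"
  then obtain A B where AB: "Z = A + B" "A \<in> T10 M q" "cconj B \<in> T10 M q"
    by (metis set_plus_elim T01_iff)
  then have "DC A = 0" "DC (cconj B) = 0" "JC A = cscale \<i> A" "JC (cconj B) = cscale \<i> (cconj B)"
    by (auto simp: T10_def CTM_iff)
  moreover from this(4) have "JC B = cscale (- \<i>) B"
    by (metis JC_cconj cconj_cconj cconj_cscale complex_cnj_i)
  ultimately show "DC (JC Z) = 0" using AB(1) by (simp add: JC_add DC_add DC_diff DC_cscale DC_cconj)
next
  assume 0: "DC (JC Z) = 0"
  \<comment> \<open>Projections to the eigenspaces of \<open>JC\<close> for i and -i.\<close>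
  define A where "A = cscale (1/2) (Z - cscale \<i> (JC Z))"
  define B where "B = cscale (1/2) (Z + cscale \<i> (JC Z))"
  have "Z = A + B" unfolding A_def B_def by (simp add: prod_eq_iff algebra_simps flip: scaleR_add_left)
  moreover have "A \<in> T10 M q"
    using assms 0 unfolding A_def T10_def
    by (simp add: CTM_iff DC_cscale DC_diff JC_cscale JC_diff JC_JC)
      (simp add: prod_eq_iff algebra_simps)
  moreover have "cconj B \<in> T10 M q"
    using assms 0 unfolding B_def T10_def
    by (simp add: CTM_iff DC_cscale DC_add DC_cconj JC_cconj JC_cscale JC_add JC_JC)
      (simp add: prod_eq_iff algebra_simps)
  ultimately show "Z \<in> T10 M q + T01 M q" by (metis set_plus_intro T01_iff)
qed


lemma T10_T01_coset:
  assumes "W \<in> T10 M q + T01 M q"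
  shows "W +o (T10 M q + T01 M q) = T10 M q + T01 M q"
proof -
  let ?S = "T10 M q + T01 M q"
  have S: "Z \<in> ?S \<longleftrightarrow> DC Z = 0 \<and> DC (JC Z) = 0" for Z
  proof
    assume Z: "Z \<in> ?S"
    then have "Z \<in> CTM M q"
      by (auto elim!: set_plus_elim simp: CTM_iff DC_add T01_def T10_def DC_cconj)
    then show "DC Z = 0 \<and> DC (JC Z) = 0" using Z T10_T01_iff CTM_iff by blast
  qed (use T10_T01_iff CTM_iff in blast)
  show ?thesis
  proof (intro equalityI subsetI)
    fix Z assume "Z \<in> ?S"
    then have "Z - W \<in> ?S" using assms unfolding S by (simp add: DC_diff JC_diff)
    then show "Z \<in> W +o ?S" using set_plus_intro2[of "Z - W" ?S W] by simp
  next
    fix Z assume "Z \<in> W +o ?S"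
    then obtain B where "Z = W + B" "B \<in> ?S" unfolding elt_set_plus_def by blast
    then show "Z \<in> ?S" using assms unfolding S by (simp add: DC_add JC_add)
  qed
qed

lemma local_section_field10:
  assumes "openin (top_of_set M) V" "q \<in> V" "local_section r V B X" "r \<noteq> Ck 0"
    and "\<And>x. x \<in> V \<Longrightarrow> B x \<subseteq> T10 M x"
  shows "field10 X"
proof -
  obtain W where W: "open W" "V = M \<inter> W" using assms(1) unfolding openin_open by blast
  have X: "of_class_on_subset r V X" "\<And>x. x \<in> V \<Longrightarrow> X x \<in> B x"
    using assms(3) unfolding local_section_def by blast+
  from bspec[OF X(1)[unfolded of_class_on_subset_def] assms(2)] obtain G g where
    g: "open G" "q \<in> G" "of_class r G g" "\<forall>x\<in>V \<inter> G. X x = g x" by (elim exE conjE)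
  have "(X has_derivative frechet_derivative g (at q)) (at q within M)"
    by (rule has_derivative_transform_within_nbhd
        [OF has_derivative_at_withinI[OF of_class_has_derivative[OF g(3) assms(4) g(2)]] q_in_M
          open_Int[OF g(1) W(1)]]) (use g W assms(2) in auto)
  moreover have "\<forall>x\<in>M \<inter> W. X x \<in> T10 M x" using X(2) W(2) assms(5) by blast
  ultimately show ?thesis unfolding field10_def using W assms(2) by blast
qed

section \<open>The Levi kernel in terms of the Hessian\<close>

text \<open>Without sections through \<open>u\<close> and \<open>v\<close> the union in
  \<open>levi_form\<close> would be empty, whereas \<open>T10 M q + T01 M q\<close> contains 0.
  Membership in the kernel therefore yields such sections, and their bracket evaluates the
  form.\<close>

lemma levi_kernel_HC:
  assumes "u \<in> levi_kernel \<kappa> M q" "v \<in> T10 M q" "lower \<kappa> 1 \<noteq> Ck 0"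
  shows "HC u (cconj v) = 0"
    and "\<exists>Y V. openin (top_of_set M) V \<and> q \<in> V \<and> local_section (lower \<kappa> 1) V (T10 M) Y \<and> Y q = v"
proof -
  let ?S = "T10 M q + T01 M q"
  have lf: "levi_form \<kappa> M q u v = ?S" using assms(1,2) unfolding levi_kernel_def by blast
  have "cconj (0 :: C3 \<times> C3) = 0" by (simp add: prod_eq_iff)
  then have "0 \<in> T01 M q" using zero_T10 by (simp add: T01_iff)
  then have 0: "0 \<in> ?S" using set_plus_intro[OF zero_T10] by (metis add_0)
  with lf have "levi_form \<kappa> M q u v \<noteq> {}" by blast
  then obtain X Y V where XY: "openin (top_of_set M) V" "q \<in> V"
    "local_section (lower \<kappa> 1) V (T10 M) X" "local_section (lower \<kappa> 1) V (T10 M) Y" "X q = u" "Y q = v"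
    unfolding levi_form_def by blast
  then show "\<exists>Y V. openin (top_of_set M) V \<and> q \<in> V \<and> local_section (lower \<kappa> 1) V (T10 M) Y \<and> Y q = v"
    by blast
  have f: "field10 X" "field10 Y"
    using local_section_field10[OF XY(1,2) _ assms(3)] XY(3,4) by blast+
  let ?W = "cscale \<i> (bracket M X (cconj \<circ> Y) q)"
  have "?W +o ?S \<subseteq> levi_form \<kappa> M q u v" unfolding levi_form_def using XY by blast
  then have "?W \<in> ?S" using set_plus_intro2[OF 0, of ?W] lf by auto
  moreover have "?W \<in> CTM M q" using bracket_cconj_T10(1)[OF f] by (simp add: CTM_iff DC_cscale)
  ultimately have "DC (JC ?W) = 0" using T10_T01_iff by blast
  then show "HC u (cconj v) = 0" using bracket_cconj_T10(2)[OF f] XY(5,6) by (simp add: JC_cscale DC_cscale)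
qed

text \<open>Vanishing of the Hermitian form makes every coset in the union the zero coset; the last
  hypothesis keeps the union nonempty.\<close>

lemma levi_kernelI:
  assumes "openin (top_of_set M) V" "q \<in> V" "local_section (lower \<kappa> 1) V (T10 M) X" "lower \<kappa> 1 \<noteq> Ck 0"
    and "\<And>v. v \<in> T10 M q \<Longrightarrow> HC (X q) (cconj v) = 0"
    and "\<And>v. v \<in> T10 M q \<Longrightarrow>
      \<exists>Y V. openin (top_of_set M) V \<and> q \<in> V \<and> local_section (lower \<kappa> 1) V (T10 M) Y \<and> Y q = v"
  shows "X q \<in> levi_kernel \<kappa> M q"
proof -
  let ?S = "T10 M q + T01 M q"
  have "levi_form \<kappa> M q (X q) v = ?S" if v: "v \<in> T10 M q" for v
  proof -
    let ?C = "{cscale \<i> (bracket M Z (cconj \<circ> Y) q) +o ?S | Z Y V.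
      openin (top_of_set M) V \<and> q \<in> V \<and>
      local_section (lower \<kappa> 1) V (T10 M) Z \<and> local_section (lower \<kappa> 1) V (T10 M) Y \<and>
      Z q = X q \<and> Y q = v}"
    have "c = ?S" if c: "c \<in> ?C" for c
    proof -
      obtain Z Y V' where *: "c = cscale \<i> (bracket M Z (cconj \<circ> Y) q) +o ?S"
        "openin (top_of_set M) V'" "q \<in> V'" "local_section (lower \<kappa> 1) V' (T10 M) Z"
        "local_section (lower \<kappa> 1) V' (T10 M) Y" "Z q = X q" "Y q = v" using c by blast
      have f: "field10 Z" "field10 Y"
        using local_section_field10[OF *(2,3) _ assms(4)] *(4,5) by blast+
      have "HC (Z q) (cconj (Y q)) = 0" using assms(5)[OF v] *(6,7) by simp
      then have "cscale \<i> (bracket M Z (cconj \<circ> Y) q) \<in> ?S"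
        using bracket_cconj_T10[OF f] by (subst T10_T01_iff) (simp_all add: CTM_iff DC_cscale JC_cscale)
      then show ?thesis unfolding *(1) by (rule T10_T01_coset)
    qed
    moreover obtain Y V' where Y: "openin (top_of_set M) V'" "q \<in> V'"
      "local_section (lower \<kappa> 1) V' (T10 M) Y" "Y q = v" using assms(6)[OF v] by blast
    \<comment> \<open>\<open>levi_form\<close> asks for both sections over one open set, hence the
      restriction to the intersection.\<close>
    have "local_section (lower \<kappa> 1) (V \<inter> V') (T10 M) X" "local_section (lower \<kappa> 1) (V \<inter> V') (T10 M) Y"
      using assms(3) Y(3) local_section_mono by (metis Int_lower1, metis Int_lower2)
    then have "cscale \<i> (bracket M X (cconj \<circ> Y) q) +o ?S \<in> ?C"
      using openin_Int[OF assms(1) Y(1)] assms(2) Y(2,4) by blast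
    ultimately have "?C = {?S}" by blast
    then show ?thesis unfolding levi_form_def by simp
  qed
  moreover have "X q \<in> T10 M q" using assms(2,3) unfolding local_section_def by blast
  ultimately show ?thesis unfolding levi_kernel_def by blast
qed

end

section \<open>Adapted frames\<close>

locale adapted_point = hypersurface_point +
  fixes \<kappa> :: regularity and V :: "C3 set" and K L1 :: cfield
  assumes adapted: "adapted_pair \<kappa> M V K L1" and q_in_V: "q \<in> V"
    and regular: "lower \<kappa> 1 \<noteq> Ck 0" "lower \<kappa> 2 \<noteq> Ck 0"
begin

lemma openin_V: "openin (top_of_set M) V"
  and frame_K: "local_frame (lower \<kappa> 2) V (levi_kernel \<kappa> M) [K]"
  and section_L1: "local_section (lower \<kappa> 1) V (T10 M) L1"
  and frame_T10: "local_frame (lower \<kappa> 2) V (T10 M) [K, L1]"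
  using adapted unfolding adapted_pair_def by auto

lemma span_K: "cplx.span {K q} = levi_kernel \<kappa> M q"
  and K_L1_distinct: "K q \<noteq> L1 q"
  and K_L1_independent: "cplx.independent {K q, L1 q}"
  and span_K_L1: "cplx.span {K q, L1 q} = T10 M q"
  using frame_K frame_T10 q_in_V unfolding local_frame_def by (auto simp: Let_def)

lemma K_levi_kernel: "K q \<in> levi_kernel \<kappa> M q"
  using span_K cplx.span_base[of "K q" "{K q}"] by simp

lemma K_T10: "K q \<in> T10 M q" and L1_T10: "L1 q \<in> T10 M q"
  using span_K_L1 cplx.span_base[of "K q" "{K q, L1 q}"] cplx.span_base[of "L1 q" "{K q, L1 q}"]
  by simp_all

lemma field10_L1: "field10 L1"
  using local_section_field10[OF openin_V q_in_V section_L1 regular(1)] by blast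

lemma HC_K: "v \<in> T10 M q \<Longrightarrow> HC (K q) (cconj v) = 0"
  using levi_kernel_HC(1)[OF K_levi_kernel _ regular(1)] .

text \<open>Hermitian symmetry of the Levi form.\<close>

lemma HC_cconj_K: "v \<in> T10 M q \<Longrightarrow> HC v (cconj (K q)) = 0"
  using HC_K[of v] HC_cconj[of "K q" "cconj v"] HC_commute[of v "cconj (K q)"] by simp

lemma T10_combination:
  assumes "v \<in> T10 M q"
  obtains b a where "v = cscale b (K q) + cscale a (L1 q)"
proof -
  have "v \<in> cplx.span {K q, L1 q}" using assms span_K_L1 by simp
  then obtain b where "v - cscale b (K q) \<in> cplx.span {L1 q}" by (auto simp: cplx.span_breakdown_eq)
  then obtain a where "v - cscale b (K q) = cscale a (L1 q)" by (auto simp: cplx.span_singleton)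
  then show thesis using that[of b a] by (simp add: algebra_simps)
qed

lemma K_nonzero: "K q \<noteq> 0"
  using K_L1_independent cplx.dependent_zero by (metis insertI1)

lemma L1_not_in_span_K: "L1 q \<notin> cplx.span {K q}"
proof -
  have "cplx.independent (insert (L1 q) {K q})" using K_L1_independent by (simp add: insert_commute)
  then show ?thesis using K_L1_distinct by (subst (asm) cplx.independent_insert) auto
qed

text \<open>A vanishing Levi form on \<open>\<L>\<^sub>1\<close> would put \<open>\<L>\<^sub>1\<close> into the Levi kernel, which is spanned by \<open>\<K>\<close>.\<close>

lemma HC_L1_nonzero: "HC (L1 q) (cconj (L1 q)) \<noteq> 0"
proof
  assume 0: "HC (L1 q) (cconj (L1 q)) = 0"
  have "L1 q \<in> levi_kernel \<kappa> M q"
  proof (rule levi_kernelI[OF openin_V q_in_V section_L1 regular(1)])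
    fix v assume v: "v \<in> T10 M q"
    show "\<exists>Y V. openin (top_of_set M) V \<and> q \<in> V \<and> local_section (lower \<kappa> 1) V (T10 M) Y \<and> Y q = v"
      by (rule levi_kernel_HC(2)[OF K_levi_kernel v regular(1)])
    obtain b a where "v = cscale b (K q) + cscale a (L1 q)" using T10_combination[OF v] .
    then show "HC (L1 q) (cconj v) = 0"
      using 0 HC_cconj_K[OF L1_T10] by (simp add: cconj_add cconj_cscale HC_add_right HC_cscale_right)
  qed
  then show False using span_K L1_not_in_span_K by simp
qed

definition T :: "C3 \<times> C3" where
  "T = cscale \<i> (bracket M L1 (cconj \<circ> L1) q)"

lemma T_CTM: "T \<in> CTM M q"
  using bracket_cconj_T10(1)[OF field10_L1 field10_L1] by (simp add: T_def CTM_iff DC_cscale)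

lemma DC_JC_T: "DC (JC T) = - 2 * HC (L1 q) (cconj (L1 q))"
  unfolding T_def JC_cscale DC_cscale bracket_cconj_T10(2)[OF field10_L1 field10_L1]
  by (simp add: complex_eq_iff)

lemma cconj_T: "cconj T = T"
  unfolding T_def by (rule cconj_bracket_self[OF field10_L1])

lemma CTM_span_minimal: "S \<subseteq> CTM M q \<Longrightarrow> cplx.span S \<subseteq> CTM M q"
  by (rule cplx.span_minimal)
    (auto simp: cplx.subspace_def CTM_iff DC_add DC_cscale, simp add: DC_def D_linear_simps complex_eq_iff)

lemma T10_inter_T01: "Z \<in> T10 M q \<Longrightarrow> cconj Z \<in> T10 M q \<Longrightarrow> Z = 0"
proof -
  assume "Z \<in> T10 M q" "cconj Z \<in> T10 M q"
  then have "JC Z = cscale \<i> Z" "JC (cconj Z) = cscale \<i> (cconj Z)" by (auto simp: T10_def)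
  then have "cscale \<i> Z = cscale (- \<i>) Z"
    by (metis JC_cconj cconj_cconj cconj_cscale complex_cnj_i)
  then show "Z = 0" by (subst (asm) cplx.scale_cancel_right) simp
qed

lemma cconj_CTM: "Z \<in> T10 M q \<Longrightarrow> cconj Z \<in> CTM M q"
  using CTM_closed(2)[OF q_in_M q_in_U] T10_CTM by blast

text \<open>The vectors are adjoined one at a time. The conjugates stay outside the preceding spans
  because \<open>T10 M q\<close> meets its conjugate only in 0; \<open>T\<close> does because
  \<open>DC (JC Z)\<close> vanishes for (1,0) and (0,1) vectors \<open>Z\<close> but not for
  \<open>T\<close>. Distinctness is recorded separately since independence is stated for a
  set.\<close>

lemma frame_distinct_independent:
  "distinct [K q, L1 q, cconj (K q), cconj (L1 q), T]
    \<and> cplx.independent {K q, L1 q, cconj (K q), cconj (L1 q), T}"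
proof -
  let ?A = "{K q, L1 q}" and ?B = "{cconj (K q), K q, L1 q}"
  let ?C = "{cconj (L1 q), cconj (K q), K q, L1 q}"
  have 1: "cconj (K q) \<notin> cplx.span ?A"
    using T10_inter_T01[OF K_T10] K_nonzero unfolding span_K_L1 by blast
  have 2: "cconj (L1 q) \<notin> cplx.span ?B"
  proof
    assume "cconj (L1 q) \<in> cplx.span ?B"
    then obtain k where "cconj (L1 q) - cscale k (cconj (K q)) \<in> T10 M q"
      unfolding cplx.span_breakdown_eq span_K_L1 by blast
    then have "cconj (L1 q - cscale (cnj k) (K q)) \<in> T10 M q" by (simp add: cconj_diff cconj_cscale)
    moreover have "L1 q - cscale (cnj k) (K q) \<in> T10 M q"
      using T10_add[OF L1_T10 T10_cscale[OF K_T10, of "- cnj k"]] by simp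
    ultimately have "L1 q - cscale (cnj k) (K q) = 0" using T10_inter_T01 by blast
    then show False using L1_not_in_span_K by (auto simp: cplx.span_singleton)
  qed
  have 3: "T \<notin> cplx.span ?C"
  proof
    assume T: "T \<in> cplx.span ?C"
    have "cplx.subspace {Z. DC (JC Z) = 0}"
      by (auto simp: cplx.subspace_def JC_add DC_add JC_cscale DC_cscale)
        (simp add: DC_def D_linear_simps complex_eq_iff)
    moreover have "DC (JC Z) = 0 \<and> DC (JC (cconj Z)) = 0" if "Z \<in> T10 M q" for Z
    proof -
      have "DC (JC Z) = 0" using that by (simp add: T10_def DC_cscale CTM_iff)
      then show ?thesis by (simp add: JC_cconj DC_cconj)
    qed
    ultimately have "cplx.span ?C \<subseteq> {Z. DC (JC Z) = 0}"
      using K_T10 L1_T10 by (intro cplx.span_minimal) auto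
    then show False using T DC_JC_T HC_L1_nonzero by auto
  qed
  have n: "cconj (K q) \<notin> ?A" "cconj (L1 q) \<notin> ?B" "T \<notin> ?C"
    using 1 2 3 subsetD[OF cplx.span_superset[of ?A]] subsetD[OF cplx.span_superset[of ?B]]
      subsetD[OF cplx.span_superset[of ?C]] by metis+
  have "cplx.independent ?B" using 1 n K_L1_independent by (subst cplx.independent_insert) auto
  then have "cplx.independent ?C" using 2 n by (subst cplx.independent_insert) auto
  then have "cplx.independent (insert T ?C)" using 3 n by (subst cplx.independent_insert) auto
  moreover have "insert T ?C = {K q, L1 q, cconj (K q), cconj (L1 q), T}" by auto
  ultimately show ?thesis using n K_L1_distinct by auto
qed

text \<open>A real vector in \<open>T\<^sup>1\<^sup>,\<^sup>0 + T\<^sup>0\<^sup>,\<^sup>1\<close> is twice the real part of a \<open>(1,0)\<close> vector.\<close>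

lemma real_combination:
  assumes "Z \<in> CTM M q" "DC (JC Z) = 0" "cconj Z = Z"
  obtains e d where "Z = cscale e (K q) + cscale d (L1 q)
    + cscale (cnj e) (cconj (K q)) + cscale (cnj d) (cconj (L1 q))"
proof -
  have "Z \<in> T10 M q + T01 M q" using T10_T01_iff assms by blast
  then obtain A B where AB: "Z = A + B" "A \<in> T10 M q" "cconj B \<in> T10 M q"
    by (metis set_plus_elim T01_iff)
  define u where "u = cscale (1/2) (A + cconj B)"
  have u: "u \<in> T10 M q" unfolding u_def by (intro T10_cscale T10_add AB)
  have "Z = cscale (1/2) (Z + cconj Z)" unfolding assms(3) by (simp add: prod_eq_iff flip: scaleR_add_left)
  also have "\<dots> = u + cconj u"
    unfolding AB(1) u_def by (simp add: prod_eq_iff algebra_simps)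
  finally have Z: "Z = u + cconj u" .
  obtain e d where "u = cscale e (K q) + cscale d (L1 q)" using T10_combination[OF u] .
  then show thesis using that[of e d] Z by (simp add: cconj_add cconj_cscale add_ac)
qed

lemma span_frame: "cplx.span {K q, L1 q, cconj (K q), cconj (L1 q), T} = CTM M q" (is "cplx.span ?F = _")
proof (intro equalityI subsetI)
  fix Z assume "Z \<in> cplx.span ?F"
  moreover have "?F \<subseteq> CTM M q"
    using T10_CTM[OF K_T10] T10_CTM[OF L1_T10] cconj_CTM[OF K_T10] cconj_CTM[OF L1_T10] T_CTM by blast
  ultimately show "Z \<in> CTM M q" using CTM_span_minimal by blast
next
  fix Z assume Z: "Z \<in> CTM M q"
  \<comment> \<open>This multiple of \<open>T\<close> brings the remainder into the kernel of the
    form, that is into \<open>T10 M q + T01 M q\<close>.\<close>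
  define t where "t = DC (JC Z) / DC (JC T)"
  let ?W = "Z - cscale t T"
  have "?W \<in> CTM M q" using Z T_CTM by (simp add: CTM_iff DC_diff DC_cscale)
  moreover have "DC (JC ?W) = 0"
  proof -
    have "DC (JC T) \<noteq> 0" using DC_JC_T HC_L1_nonzero by simp
    then show ?thesis by (simp add: JC_diff DC_diff JC_cscale DC_cscale t_def)
  qed
  ultimately have "?W \<in> T10 M q + T01 M q" using T10_T01_iff by blast
  then obtain A B where AB: "?W = A + B" "A \<in> T10 M q" "cconj B \<in> T10 M q"
    by (metis set_plus_elim T01_iff)
  obtain b a where A: "A = cscale b (K q) + cscale a (L1 q)" using T10_combination[OF AB(2)] .
  obtain b' a' where "cconj B = cscale b' (K q) + cscale a' (L1 q)" using T10_combination[OF AB(3)] .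
  then have "B = cscale (cnj b') (cconj (K q)) + cscale (cnj a') (cconj (L1 q))"
    by (metis cconj_add cconj_cconj cconj_cscale)
  then have "Z = cscale b (K q) + cscale a (L1 q) + (cscale (cnj b') (cconj (K q)) + cscale (cnj a') (cconj (L1 q)))
      + cscale t T"
    using AB(1) A by (metis diff_add_cancel)
  also have "\<dots> \<in> cplx.span ?F"
    by (intro cplx.span_add cplx.span_scale cplx.span_base) auto
  finally show "Z \<in> cplx.span ?F" .
qed

end

text \<open>Both interpretations share \<open>M\<close>, \<open>U\<close>, \<rho> and
  \<open>q\<close>, hence the same \<open>DC\<close> and \<open>HC\<close>, which makes the two
  transversal vectors comparable.\<close>

lemma adapted_pair_change:
  assumes "adapted_point M U \<rho> q \<kappa> V K L1" "adapted_point M U \<rho> q \<kappa> V K' L1'"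
  shows "\<exists>A\<in>G_IV2_initial. frame_column (associated_frame M K' L1') q
    = act A (frame_column (associated_frame M K L1) q)"
proof -
  interpret F: adapted_point M U \<rho> q \<kappa> V K L1 by fact
  interpret F': adapted_point M U \<rho> q \<kappa> V K' L1' by fact
  have "K' q \<in> cplx.span {K q}" using F'.K_levi_kernel F.span_K by simp
  then obtain c where c: "K' q = cscale c (K q)" by (auto simp: cplx.span_singleton)
  have "c \<noteq> 0" using c F'.K_nonzero by auto
  obtain b a where ba: "L1' q = cscale b (K q) + cscale a (L1 q)" using F.T10_combination[OF F'.L1_T10] .
  have "a \<noteq> 0"
  proof
    assume "a = 0"
    then have "L1' q = cscale (b / c) (K' q)" using ba c \<open>c \<noteq> 0\<close> by simp
    then show False using F'.L1_not_in_span_K by (auto simp: cplx.span_singleton)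
  qed
  let ?Z = "F'.T - cscale (a * cnj a) F.T"
  \<comment> \<open>The cross terms vanish because \<open>K q\<close> lies in the Levi kernel, so
    only the square of the modulus of \<open>a\<close> survives.\<close>
  have "F.HC (L1' q) (cconj (L1' q)) = a * cnj a * F.HC (L1 q) (cconj (L1 q))"
    unfolding ba using F.HC_K[OF F.K_T10] F.HC_K[OF F.L1_T10] F.HC_cconj_K[OF F.L1_T10]
    by (simp add: cconj_add cconj_cscale F.HC_add_left F.HC_add_right F.HC_cscale_left F.HC_cscale_right)
  then have "F.DC (JC ?Z) = 0"
    using F.DC_JC_T F'.DC_JC_T by (simp add: JC_diff F.DC_diff JC_cscale F.DC_cscale)
  moreover have "?Z \<in> CTM M q"
    using F.T_CTM F'.T_CTM by (simp add: F.CTM_iff F.DC_diff F.DC_cscale)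
  moreover have "cconj ?Z = ?Z"
    by (simp add: cconj_diff cconj_cscale F.cconj_T F'.cconj_T mult.commute)
  ultimately obtain e d where "?Z = cscale e (K q) + cscale d (L1 q)
    + cscale (cnj e) (cconj (K q)) + cscale (cnj d) (cconj (L1 q))"
    using F.real_combination by blast
  then have T': "F'.T = cscale e (K q) + cscale d (L1 q)
    + cscale (cnj e) (cconj (K q)) + cscale (cnj d) (cconj (L1 q)) + cscale (a * cnj a) F.T"
    by (metis diff_add_cancel)
  have "frame_column (associated_frame M K' L1') q
    = act (IV2_matrix a b c d e) (frame_column (associated_frame M K L1) q)"
    using c ba T'
    by (simp add: vec_eq_iff forall_5 act_def sum_5 frame_column_def associated_frame_def
        cconj_add cconj_cscale F.T_def F'.T_def)
  moreover have "IV2_matrix a b c d e \<in> G_IV2_initial"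
    using \<open>a \<noteq> 0\<close> \<open>c \<noteq> 0\<close> unfolding G_IV2_initial_iff by blast
  ultimately show ?thesis by blast
qed

section \<open>Regularity of the transversal field\<close>

lemma of_class_on_subset_linear:
  assumes "of_class_on_subset r V f" "bounded_linear h"
  shows "of_class_on_subset r V (\<lambda>x. h (f x))"
  unfolding of_class_on_subset_def
proof
  fix p assume "p \<in> V"
  from bspec[OF assms(1)[unfolded of_class_on_subset_def] this] obtain U g where
    U: "open U" "p \<in> U" "of_class r U g" "\<forall>x\<in>V \<inter> U. f x = g x" by (elim exE conjE)
  show "\<exists>U g. open U \<and> p \<in> U \<and> of_class r U g \<and> (\<forall>x\<in>V \<inter> U. h (f x) = g x)"
    using U of_class_linear[OF U(1) assms(2) U(3)]
    by (intro exI[of _ U] exI[of _ "\<lambda>x. h (g x)"]) auto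
qed

text \<open>Near each point the field is replaced by an ambient extension of class \<open>r\<close>.
  The bracket formula written with the ordinary derivative of that extension is of class
  \<open>lower r 1\<close> and agrees with the bracket on \<open>V\<close>.\<close>

lemma of_class_on_subset_bracket:
  assumes "openin (top_of_set M) V" "of_class_on_subset r V X" "r \<noteq> Ck 0"
    and "\<And>p. p \<in> V \<Longrightarrow> \<exists>U \<rho>. hypersurface_point M U \<rho> p"
    and "\<And>p. p \<in> V \<Longrightarrow> X p \<in> CTM M p"
  shows "of_class_on_subset (lower r 1) V (\<lambda>p. cscale c (bracket M X (cconj \<circ> X) p))"
  unfolding of_class_on_subset_def
proof
  obtain W where W: "open W" "V = M \<inter> W" using assms(1) unfolding openin_open by blast
  fix p assume p: "p \<in> V"
  from bspec[OF assms(2)[unfolded of_class_on_subset_def] p] obtain G g where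
    g: "open G" "p \<in> G" "of_class r G g" "\<forall>x\<in>V \<inter> G. X x = g x" by (elim exE conjE)
  define g' where "g' x = frechet_derivative g (at x)" for x
  \<comment> \<open>The bracket formula for the extension \<open>g\<close>, with differences written
    as sums with \<open>(- 1) *\<^sub>R\<close> so that closure under sums and linear maps
    applies.\<close>
  define Y where "Y x = cscale c ((cconj (g' x (fst (g x))) + cscale \<i> (cconj (g' x (snd (g x)))))
      + (- 1) *\<^sub>R (g' x (fst (g x)) + cscale \<i> ((- 1) *\<^sub>R g' x (snd (g x)))))" for x
  have along: "of_class (lower r 1) G (\<lambda>x. g' x (fst (g x)))"
    "of_class (lower r 1) G (\<lambda>x. g' x (snd (g x)))"
    unfolding g'_def
    by (intro of_class_derivative_along g(1,3) assms(3) of_class_lower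
        of_class_linear[OF g(1) bounded_linear_fst] of_class_linear[OF g(1) bounded_linear_snd])+
  have "of_class (lower r 1) G Y"
    unfolding Y_def
    by (intro of_class_add of_class_linear[OF g(1) bounded_linear_cscale]
        of_class_linear[OF g(1) bounded_linear_scaleR_right]
        of_class_linear[OF g(1) bounded_linear_cconj] along g(1))
  moreover have "cscale c (bracket M X (cconj \<circ> X) x) = Y x" if x: "x \<in> V \<inter> G" for x
  proof -
    obtain U \<rho> where "hypersurface_point M U \<rho> x" using assms(4) x by blast
    then interpret hypersurface_point M U \<rho> x .
    have X: "(X has_derivative g' x) (at x within M)"
      unfolding g'_def
      by (rule has_derivative_transform_within_nbhd
          [OF has_derivative_at_withinI[OF of_class_has_derivative[OF g(3) assms(3)]] q_in_M
            open_Int[OF g(1) W(1)]]) (use g(4) W(2) x in auto)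
    have d: "((cconj \<circ> X) has_derivative (\<lambda>a. cconj (g' x a))) (at x within M)"
      unfolding o_def by (rule bounded_linear.has_derivative[OF bounded_linear_cconj X])
    have Xx: "X x \<in> CTM M x" "cconj (X x) \<in> CTM M x"
      using assms(5) x CTM_closed(2)[OF q_in_M q_in_U] by auto
    have "X x = g x" using g(4) x by blast
    then show ?thesis
      unfolding bracket_def o_apply deriv_along_eq[OF d Xx(1)] deriv_along_eq[OF X Xx(2)] Y_def
      by (simp add: linear_neg[OF has_derivative_linear[OF X]])
  qed
  ultimately show "\<exists>U g. open U \<and> p \<in> U \<and> of_class (lower r 1) U g \<and>
    (\<forall>x\<in>V \<inter> U. cscale c (bracket M X (cconj \<circ> X) x) = g x)"
    using g(1,2) by blast
qed

section \<open>The reduction\<close>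

text \<open>One \<open>U\<close> and \<rho> must serve all adapted pairs at \<open>q\<close>, since
  two of them are compared in the same locale.\<close>

lemma class_IV2_adapted_point:
  assumes "class_IV2 \<kappa> M" "(\<exists>k\<ge>4. \<kappa> = Ck k) \<or> \<kappa> = Cinf \<or> \<kappa> = Comega" "q \<in> M"
  obtains U \<rho> where "hypersurface_point M U \<rho> q"
    "\<And>V K L1. adapted_pair \<kappa> M V K L1 \<Longrightarrow> q \<in> V \<Longrightarrow> adapted_point M U \<rho> q \<kappa> V K L1"
proof -
  obtain U \<rho> where U: "q \<in> U" "local_defining_function \<kappa> M U \<rho>"
    using assms(1,3) unfolding class_IV2_def real_hypersurface_def by blast
  have "of_class (Ck 2) U \<rho>"
    using assms(2) U(2) Ck_on_mono[of _ U \<rho> 2] unfolding local_defining_function_def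
    by (cases \<kappa>) auto
  then have "local_defining_function (Ck 2) M U \<rho>"
    using U(2) unfolding local_defining_function_def by blast
  then have P: "hypersurface_point M U \<rho> q" using U(1) assms(3) by unfold_locales
  moreover have "lower \<kappa> 1 \<noteq> Ck 0" "lower \<kappa> 2 \<noteq> Ck 0" using assms(2) by auto
  ultimately show thesis
    using that by (simp add: adapted_point_def adapted_point_axioms_def)
qed

text \<open>The last conjunct expresses that the group has real dimension 10.\<close>

theorem mainTheorem6:
  fixes M :: "C3 set" and \<kappa> :: regularity
  assumes "connected M"
    and "(\<exists>k\<ge>4. \<kappa> = Ck k) \<or> \<kappa> = Cinf \<or> \<kappa> = Comega"
    and "class_IV2 \<kappa> M"
  shows "(\<forall>V K L1. adapted_pair \<kappa> M V K L1 \<longrightarrow>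
           local_frame (lower \<kappa> 2) V (CTM M) (associated_frame M K L1))
    \<and> performs_reduction \<kappa> M G_IV2_initial
    \<and> embedded_submanifold Cinf 10 G_IV2_initial"
proof (intro conjI allI impI)
  fix V K L1 assume ad: "adapted_pair \<kappa> M V K L1"
  have V: "openin (top_of_set M) V" and L1: "of_class_on_subset (lower \<kappa> 1) V L1"
    and K2: "of_class_on_subset (lower \<kappa> 2) V K" and L2: "of_class_on_subset (lower \<kappa> 2) V L1"
    using ad unfolding adapted_pair_def local_section_def local_frame_def by auto
  have V_M: "q \<in> M" if "q \<in> V" for q using V that openin_imp_subset by blast
  have point: "\<exists>U \<rho>. adapted_point M U \<rho> q \<kappa> V K L1" if "q \<in> V" for q
    using class_IV2_adapted_point[OF assms(3,2) V_M[OF that]] ad that by metis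
  have L1_CTM: "L1 q \<in> CTM M q" if q: "q \<in> V" for q
  proof -
    obtain U \<rho> where "adapted_point M U \<rho> q \<kappa> V K L1" using point[OF q] by blast
    then interpret adapted_point M U \<rho> q \<kappa> V K L1 .
    show ?thesis by (rule T10_CTM[OF L1_T10])
  qed
  \<comment> \<open>\<open>L1\<close> has class \<open>lower \<kappa> 1\<close>, so the bracket,
    which costs one derivative, still has the class \<open>lower \<kappa> 2\<close> demanded of the
    whole frame.\<close>
  have "lower \<kappa> 1 \<noteq> Ck 0" "lower (lower \<kappa> 1) 1 = lower \<kappa> 2" using assms(2) by auto
  moreover have "\<exists>U \<rho>. hypersurface_point M U \<rho> p" if "p \<in> V" for p
    using point[OF that] adapted_point.axioms(1) by blast
  ultimately have T: "of_class_on_subset (lower \<kappa> 2) V (\<lambda>q. cscale \<i> (bracket M L1 (cconj \<circ> L1) q))"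
    using of_class_on_subset_bracket[OF V L1 _ _ L1_CTM] by metis
  have smooth: "of_class_on_subset (lower \<kappa> 2) V X" if "X \<in> set (associated_frame M K L1)" for X
    using that T K2 L2 of_class_on_subset_linear[OF K2 bounded_linear_cconj]
      of_class_on_subset_linear[OF L2 bounded_linear_cconj]
    by (auto simp: associated_frame_def o_def)
  have fr: "distinct vs \<and> cplx.independent (set vs) \<and> cplx.span (set vs) = CTM M q"
    if q: "q \<in> V" and vs: "vs = map (\<lambda>X. X q) (associated_frame M K L1)" for q vs
  proof -
    obtain U \<rho> where "adapted_point M U \<rho> q \<kappa> V K L1" using point[OF q] by blast
    then interpret adapted_point M U \<rho> q \<kappa> V K L1 .
    show ?thesis
      using frame_distinct_independent span_frame unfolding vs T_def associated_frame_def by simp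
  qed
  have tangent: "X q \<in> CTM M q" if "X \<in> set (associated_frame M K L1)" "q \<in> V" for X q
  proof -
    have "X q \<in> set (map (\<lambda>X. X q) (associated_frame M K L1))" using that(1) by simp
    from cplx.span_base[OF this] show ?thesis using fr[OF that(2) refl] by simp
  qed
  show "local_frame (lower \<kappa> 2) V (CTM M) (associated_frame M K L1)"
    unfolding local_frame_def local_section_def Let_def
    by (intro conjI ballI smooth tangent fr[OF _ refl, THEN conjunct1] fr[OF _ refl, THEN conjunct2, THEN conjunct1]
        fr[OF _ refl, THEN conjunct2, THEN conjunct2])
next
  show "performs_reduction \<kappa> M G_IV2_initial"
    unfolding performs_reduction_def
  proof (intro conjI allI impI)
    fix V K L1 K' L1'
    assume ad: "adapted_pair \<kappa> M V K L1 \<and> adapted_pair \<kappa> M V K' L1'"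
    \<comment> \<open>The matrices are found pointwise and assembled into a function by
      choice.\<close>
    have "\<forall>q\<in>V. \<exists>A. A \<in> G_IV2_initial \<and> frame_column (associated_frame M K' L1') q
      = act A (frame_column (associated_frame M K L1) q)"
    proof
      fix q assume q: "q \<in> V"
      have "q \<in> M" using ad q openin_imp_subset unfolding adapted_pair_def by blast
      then obtain U \<rho> where "\<And>V K L1. adapted_pair \<kappa> M V K L1 \<Longrightarrow> q \<in> V \<Longrightarrow> adapted_point M U \<rho> q \<kappa> V K L1"
        using class_IV2_adapted_point[OF assms(3,2)] by metis
      then have "adapted_point M U \<rho> q \<kappa> V K L1" "adapted_point M U \<rho> q \<kappa> V K' L1'"
        using ad q by blast+
      then show "\<exists>A. A \<in> G_IV2_initial \<and> frame_column (associated_frame M K' L1') q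
        = act A (frame_column (associated_frame M K L1) q)"
        using adapted_pair_change by blast
    qed
    then show "\<exists>A. \<forall>q\<in>V. A q \<in> G_IV2_initial \<and> frame_column (associated_frame M K' L1') q
      = act (A q) (frame_column (associated_frame M K L1) q)"
      by (rule bchoice)
  qed (rule subgroup_G_IV2_initial closedin_G_IV2_initial)+
next
  show "embedded_submanifold Cinf 10 G_IV2_initial" by (rule embedded_submanifold_G_IV2_initial)
qed

end
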